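(* Let $(\Omega,\Sigma,\mu)$ be a measure space and let $Y$ be a real strictly convex Banach space. Given $u\in L_1(\mu)\widehat{\otimes}_\pi Y$, the following assertions are equivalent: (i) $u\in\mathrm{NA}_\pi(L_1(\mu)\widehat{\otimes}_\pi Y)$. (ii) $u=\sum_{i=1}^\infty f_i\otimes y_i$ for some $f_i\in L_1(\mu)$, $y_i\in Y$ with $\mu(\operatorname{supp} f_i\cap\operatorname{supp} f_j)=0$ for all $i\neq j$. (iii) $P\circ u$ is essentially countably valued, where $P:Y\to S_Y\cup\{0\}$ is given by $P(y)=\frac{y}{\|y\|}$ if $y\neq0$ and $P(0)=0$. (iv) There is an essentially countably valued $g\in S_{L_\infty(\mu,Y^* )}$ with $\langle g,u\rangle=\|u\|$. (v) $u$ attains its total variation.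
   Context: $X\widehat{\otimes}_\pi Y$ denotes the projective tensor product. An element $u\in X\widehat{\otimes}_\pi Y$ attains its projective norm if there are $(x_i)\subseteq X$, $(y_i)\subseteq Y$ with $u=\sum_{i=1}^\infty x_i\otimes y_i$ and $\|u\|_\pi=\sum_{i=1}^\infty\|x_i\|\|y_i\|$; $\mathrm{NA}_\pi(X\widehat{\otimes}_\pi Y)$ is the set of such elements. $L_1(\mu)\widehat{\otimes}_\pi Y$ is isometrically identified with the space $L_1(\mu,Y)$ of Bochner integrable functions via $(f\otimes y)(\omega)=f(\omega)y$. $\operatorname{supp} f=\{\omega: f(\omega)\neq0\}$ (up to a null set). $S_Z$ is the unit sphere of a Banach space $Z$. $Y$ is strictly convex if $\|x+y\|<2$ for all distinct $x,y\in S_Y$. $L_\infty(\mu,Y^* )$ is the space of essentially bounded strongly measurable functions $\Omega\to Y^*$ with the essential supremum norm, acting on $L_1(\mu,Y)$ by $\langle g,u\rangle=\int_\Omega g(\omega)(u(\omega))\,d\mu$. A measurable map $f$ is essentially countably valued if there is $N\in\Sigma$ with $\mu(N)=0$ such that $\{f(\omega):\omega\notin N\}$ is countable. For $u\in L_1(\mu,Y)$ let $\nu_u(A)=\int_A u\,d\mu$ for $A\in\Sigma$, and $|\nu_u|_1(\Omega)=\sup\sum_{i=1}^n\|\nu_u(A_i)\|$, the supremum over finite measurable partitions $\{A_1,\dots,A_n\}$ of $\Omega$. $u$ attains its total variation if there is a sequence of pairwise disjoint sets $(A_n)_{n=1}^\infty\subseteq\Sigma$ with $|\nu_u|_1(\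Omega)=\sum_{n=1}^\infty\|\nu_u(A_n)\|$.
   Formalization: The equivalence with (iv) is claimed only when μ(Ω) ≠ 0 and Y ≠ {0}; otherwise L_∞(μ,Y* ) = {0} has an empty unit sphere, so (iv) fails while (i), (ii), (iii), (v) hold for u = 0. The other equivalences are unrestricted. *)

theory Defs
  imports "HOL-Analysis.Analysis" "HOL-Probability.Essential_Supremum"
begin

text \<open>The library's Bochner integral is restricted to second countable Banach spaces.  The
  definitions below follow the library's \<open>has_bochner_integral\<close>, \<open>integrable\<close> and
  \<open>lebesgue_integral\<close> for arbitrary normed spaces, with Borel measurability replaced by strong
  measurability.  Elements of the Lebesgue-Bochner spaces are handled through representatives;
  every class modulo null sets has a representative that is a pointwise limit of simple functions
  everywhere on the space.\<close>

definition strongly_measurable :: "'a measure \<Rightarrow> ('a \<Rightarrow> 'b::topological_space) \<Rightarrow> bool" where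
  "strongly_measurable M f \<longleftrightarrow>
    (\<exists>s. (\<forall>i. simple_function M (s i)) \<and> (\<forall>\<omega>\<in>space M. (\<lambda>i. s i \<omega>) \<longlonglongrightarrow> f \<omega>))"

definition has_strong_bochner_integral ::
    "'a measure \<Rightarrow> ('a \<Rightarrow> 'b::real_normed_vector) \<Rightarrow> 'b \<Rightarrow> bool" where
  "has_strong_bochner_integral M f x \<longleftrightarrow> strongly_measurable M f \<and>
    (\<exists>s. (\<forall>i. Bochner_Integration.simple_bochner_integrable M (s i)) \<and>
      (\<lambda>i. \<integral>\<^sup>+\<omega>. ennreal (norm (f \<omega> - s i \<omega>)) \<partial>M) \<longlonglongrightarrow> 0 \<and>
      (\<lambda>i. Bochner_Integration.simple_bochner_integral M (s i)) \<longlonglongrightarrow> x)"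

definition bochner_integrable :: "'a measure \<Rightarrow> ('a \<Rightarrow> 'b::real_normed_vector) \<Rightarrow> bool" where
  "bochner_integrable M f \<longleftrightarrow> (\<exists>x. has_strong_bochner_integral M f x)"

definition bochner_integral :: "'a measure \<Rightarrow> ('a \<Rightarrow> 'b::real_normed_vector) \<Rightarrow> 'b" where
  "bochner_integral M f = (THE x. has_strong_bochner_integral M f x)"

definition L1_norm :: "'a measure \<Rightarrow> ('a \<Rightarrow> 'b::real_normed_vector) \<Rightarrow> real" where
  "L1_norm M u = (\<integral>\<omega>. norm (u \<omega>) \<partial>M)"

text \<open>The projective tensor product of \<open>L\<^sub>1(\<mu>)\<close> and \<open>Y\<close> is identified with \<open>L\<^sub>1(\<mu>, Y)\<close>, the
  elementary tensor of \<open>f\<close> and \<open>y\<close> being \<open>\<lambda>\<omega>. f \<omega> *\<^sub>R y\<close>.  The predicate \<open>tensor_series M f y u\<close> says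
  that \<open>u\<close> is the sum of the series of the elementary tensors of \<open>f i\<close> and \<open>y i\<close>, in the norm of
  \<open>L\<^sub>1(\<mu>, Y)\<close>.\<close>

definition tensor_series ::
    "'a measure \<Rightarrow> (nat \<Rightarrow> 'a \<Rightarrow> real) \<Rightarrow> (nat \<Rightarrow> 'b::real_normed_vector) \<Rightarrow> ('a \<Rightarrow> 'b) \<Rightarrow> bool" where
  "tensor_series M f y u \<longleftrightarrow> (\<forall>i. integrable M (f i)) \<and>
    (\<lambda>n. \<integral>\<^sup>+\<omega>. ennreal (norm (u \<omega> - (\<Sum>i<n. f i \<omega> *\<^sub>R y i))) \<partial>M) \<longlonglongrightarrow> 0"

text \<open>The projective norm is defined as the infimum over representations; its agreement with
  \<open>L1_norm\<close> is not built in.\<close>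

definition projective_norm :: "'a measure \<Rightarrow> ('a \<Rightarrow> 'b::real_normed_vector) \<Rightarrow> real" where
  "projective_norm M u =
    Inf {r. \<exists>f y. tensor_series M f y u \<and> (\<lambda>i. L1_norm M (f i) * norm (y i)) sums r}"

definition attains_projective_norm :: "'a measure \<Rightarrow> ('a \<Rightarrow> 'b::real_normed_vector) \<Rightarrow> bool" where
  "attains_projective_norm M u \<longleftrightarrow>
    (\<exists>f y. tensor_series M f y u \<and>
      (\<lambda>i. L1_norm M (f i) * norm (y i)) sums projective_norm M u)"

definition supp_on :: "'a measure \<Rightarrow> ('a \<Rightarrow> 'b::zero) \<Rightarrow> 'a set" where
  "supp_on M f = {\<omega> \<in> space M. f \<omega> \<noteq> 0}"

definition strictly_convex_space :: "'b::real_normed_vector itself \<Rightarrow> bool" where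
  "strictly_convex_space _ \<longleftrightarrow>
    (\<forall>x y::'b. norm x = 1 \<and> norm y = 1 \<and> x \<noteq> y \<longrightarrow> norm (x + y) < 2)"

definition essentially_countably_valued ::
    "'a measure \<Rightarrow> ('a \<Rightarrow> 'b::topological_space) \<Rightarrow> bool" where
  "essentially_countably_valued M f \<longleftrightarrow> f \<in> borel_measurable M \<and>
    (\<exists>N\<in>null_sets M. countable (f ` (space M - N)))"

text \<open>This sphere is empty when the space is a null set or the value space is trivial.  The norm-radial
  retraction of a normed space onto its unit sphere together with \<open>0\<close> is the library's \<open>sgn\<close>.\<close>

definition Linf_unit_sphere :: "'a measure \<Rightarrow> ('a \<Rightarrow> 'b::real_normed_vector) set" where
  "Linf_unit_sphere M =
    {g. strongly_measurable M g \<and> esssup M (\<lambda>\<omega>. ereal (norm (g \<omega>))) = 1}"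

definition dual_pairing ::
    "'a measure \<Rightarrow> ('a \<Rightarrow> 'b::real_normed_vector \<Rightarrow>\<^sub>L real) \<Rightarrow> ('a \<Rightarrow> 'b) \<Rightarrow> real" where
  "dual_pairing M g u = (\<integral>\<omega>. blinfun_apply (g \<omega>) (u \<omega>) \<partial>M)"

definition indefinite_integral ::
    "'a measure \<Rightarrow> ('a \<Rightarrow> 'b::real_normed_vector) \<Rightarrow> 'a set \<Rightarrow> 'b" where
  "indefinite_integral M u A = bochner_integral M (\<lambda>\<omega>. indicator A \<omega> *\<^sub>R u \<omega>)"

text \<open>For Bochner integrable \<open>u\<close> the supremum is taken over a nonempty set of reals that is bounded
  above by \<open>L1_norm M u\<close>.\<close>

definition total_variation :: "'a measure \<Rightarrow> ('a \<Rightarrow> 'b::real_normed_vector) \<Rightarrow> real" where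
  "total_variation M u =
    (SUP P \<in> {P. finite P \<and> P \<subseteq> sets M \<and> partition_on (space M) P}.
      \<Sum>A\<in>P. norm (indefinite_integral M u A))"

definition attains_total_variation :: "'a measure \<Rightarrow> ('a \<Rightarrow> 'b::real_normed_vector) \<Rightarrow> bool" where
  "attains_total_variation M u \<longleftrightarrow>
    (\<exists>A::nat \<Rightarrow> 'a set. range A \<subseteq> sets M \<and> disjoint_family A \<and>
      (\<lambda>n. norm (indefinite_integral M u (A n))) sums total_variation M u)"

end

theory Submission
  imports Defs
begin

text \<open>Assertion (iii) is the hub. On a level set of \<open>sgn \<circ> u\<close> the function \<open>u\<close> is a
  nonnegative scalar function times a fixed vector; splitting \<open>u\<close> along countably many such sets
  loses no norm, which gives the optimal representation in (i) and (ii), the piecewise constant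
  norming \<open>g\<close> in (iv), and the family of sets in (v). Conversely, attainment in (i), (iv) or (v)
  turns an inequality between integrals into a pointwise equality \<open>\<phi> (u \<omega>) = norm (u \<omega>)\<close> almost
  everywhere, with \<open>\<phi>\<close> a functional of norm at most 1 which, in each case, determines \<open>sgn (u \<omega>)\<close>
  by strict convexity up to countably many choices. For this the infima and suprema must be identified:
  both the projective norm and the total variation equal the \<open>L\<^sub>1\<close>-norm, by approximation with simple
  functions, which attain both. Norming functionals are obtained as minimal sublinear
  functionals.\<close>

section \<open>Norming functionals and strict convexity\<close>

text \<open>\<open>Y\<close> may be nonseparable, so vector-valued integrals are handled through
  scalar ones: a functional of norm at most 1 that norms the vector in question is moved under the
  integral sign. The countable set of directions has a different origin in each case: (i) and (ii)
  allow only \<open>sgn (y i)\<close>, \<open>- sgn (y i)\<close> and 0, (iv) gives one direction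
  for each value of \<open>g\<close>, and (v) gives one for each set \<open>A n\<close>, that of the
  integral over it.

  A tensor series converges in L1 only, while directions are read off pointwise. In (i) the finite
  cost makes the series absolutely convergent almost everywhere; in (ii), where the cost is not
  controlled, disjointness leaves at most one nonzero term at almost every point.

  The projective norm is an infimum over all representations, so its value must be found for
  arbitrary \<open>u\<close>, whose directions may be uncountable. A telescoping series of simple
  functions approaches the bound: each difference is represented without loss, and the differences
  after the first have small total norm.\<close>

definition sublinear :: "('a::real_vector \<Rightarrow> real) \<Rightarrow> bool" where
  "sublinear p \<longleftrightarrow> (\<forall>x y. p (x + y) \<le> p x + p y) \<and> (\<forall>t\<ge>0. \<forall>x. p (t *\<^sub>R x) \<le> t * p x)"

lemma sublinear_add: "sublinear p \<Longrightarrow> p (x + y) \<le> p x + p y"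
  by (simp add: sublinear_def)

lemma sublinear_scale_le: "sublinear p \<Longrightarrow> t \<ge> 0 \<Longrightarrow> p (t *\<^sub>R x) \<le> t * p x"
  by (simp add: sublinear_def)

lemma sublinear_zero: "sublinear p \<Longrightarrow> p 0 = 0"
  using sublinear_add[of p 0 0] sublinear_scale_le[of p 0 0] by simp

text \<open>The reverse inequality is the assumed one for the factor \<open>1 / t\<close>. The
  definition can therefore ask for one inequality only, which is what a pointwise infimum
  delivers.\<close>

lemma sublinear_scale:
  assumes "sublinear p" "t \<ge> 0"
  shows "p (t *\<^sub>R x) = t * p x"
proof (cases "t = 0")
  case False
  then have t: "t > 0" using assms by simp
  have "p x \<le> (1 / t) * p (t *\<^sub>R x)"
    using sublinear_scale_le[OF assms(1), of "1 / t" "t *\<^sub>R x"] t by simp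
  then have "t * p x \<le> p (t *\<^sub>R x)" using t by (simp add: field_simps)
  with sublinear_scale_le[OF assms] show ?thesis by (rule order.antisym)
qed (use sublinear_zero[OF assms(1)] in simp)

text \<open>Provides the pointwise lower bound that keeps infima over chains of sublinear
  functionals finite.\<close>

lemma sublinear_neg: "sublinear p \<Longrightarrow> - p (- x) \<le> p x"
  using sublinear_add[of p x "- x"] sublinear_zero[of p] by simp

text \<open>Tilting in direction \<open>y\<close> forces a minimal sublinear functional to be additive there.\<close>

lemma sublinear_tilt:
  assumes p: "sublinear p"
  obtains r where "sublinear r" "\<And>x. r x \<le> p x" "\<And>x. r x \<le> p (x + y) - p y"
proof
  \<comment> \<open>The parameter \<open>t = 0\<close> gives the first bound and
    \<open>t = 1\<close> the second. Admitting every nonnegative \<open>t\<close> makes the infimum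
    sublinear, because parameters add and rescale together with the argument.\<close>
  define r where "r x = (INF t\<in>{0..}. p (x + t *\<^sub>R y) - t * p y)" for x
  have bdd: "bdd_below ((\<lambda>t. p (x + t *\<^sub>R y) - t * p y) ` {0..})" for x
  proof (rule bdd_belowI2)
    fix t :: real assume "t \<in> {0..}"
    then have "t * p y = p (t *\<^sub>R y)" using sublinear_scale[OF p] by simp
    also have "\<dots> \<le> p (x + t *\<^sub>R y) + p (- x)"
      using sublinear_add[OF p, of "x + t *\<^sub>R y" "- x"] by simp
    finally show "- p (- x) \<le> p (x + t *\<^sub>R y) - t * p y" by simp
  qed
  have upper: "r x \<le> p (x + t *\<^sub>R y) - t * p y" if "t \<ge> 0" for x t
    unfolding r_def by (rule cINF_lower[OF bdd]) (use that in simp)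
  show "r x \<le> p x" for x using upper[of 0 x] by simp
  show "r x \<le> p (x + y) - p y" for x using upper[of 1 x] by simp
  show "sublinear r"
    unfolding sublinear_def
  proof (intro conjI allI impI)
    fix x x'
    have "r (x + x') - (p (x + t *\<^sub>R y) - t * p y) \<le> p (x' + t' *\<^sub>R y) - t' * p y"
      if "t \<ge> 0" "t' \<ge> 0" for t t'
    proof -
      have "r (x + x') \<le> p ((x + t *\<^sub>R y) + (x' + t' *\<^sub>R y)) - (t + t') * p y"
        using upper[of "t + t'" "x + x'"] that by (simp add: algebra_simps)
      then show ?thesis
        using sublinear_add[OF p, of "x + t *\<^sub>R y" "x' + t' *\<^sub>R y"] by (simp add: algebra_simps)
    qed
    then have "r (x + x') - (p (x + t *\<^sub>R y) - t * p y) \<le> r x'" if "t \<ge> 0" for t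
      unfolding r_def[of x'] by (intro cINF_greatest) (use that in auto)
    then have "r (x + x') - r x' \<le> p (x + t *\<^sub>R y) - t * p y" if "t \<ge> 0" for t
      using that by (smt (verit))
    then have "r (x + x') - r x' \<le> r x"
      unfolding r_def[of x] by (intro cINF_greatest) auto
    then show "r (x + x') \<le> r x + r x'" by simp
  next
    fix s :: real and x assume "s \<ge> 0"
    show "r (s *\<^sub>R x) \<le> s * r x"
    proof (cases "s = 0")
      case True
      then show ?thesis using upper[of 0 0] sublinear_zero[OF p] by simp
    next
      case False
      with \<open>s \<ge> 0\<close> have s: "s > 0" by simp
      have "r (s *\<^sub>R x) / s \<le> p (x + t *\<^sub>R y) - t * p y" if "t \<ge> 0" for t
      proof -
        have "r (s *\<^sub>R x) \<le> p (s *\<^sub>R (x + t *\<^sub>R y)) - (s * t) * p y"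
          using upper[of "s * t" "s *\<^sub>R x"] that s by (simp add: algebra_simps)
        also have "\<dots> = s * (p (x + t *\<^sub>R y) - t * p y)"
          using sublinear_scale[OF p, of s "x + t *\<^sub>R y"] s by (simp add: algebra_simps)
        finally show ?thesis using s by (simp add: field_simps)
      qed
      then have "r (s *\<^sub>R x) / s \<le> r x"
        unfolding r_def[of x] by (intro cINF_greatest) auto
      then show ?thesis using s by (simp add: field_simps)
    qed
  qed
qed

text \<open>Zorn's lemma downwards: the pointwise infimum of a nonempty chain is again sublinear and
  bounds the chain from below.\<close>

lemma minimal_sublinear_below:
  assumes q: "sublinear q"
  obtains p where "sublinear p" "\<And>x. p x \<le> q x"
    "\<And>r. sublinear r \<Longrightarrow> (\<And>x. r x \<le> p x) \<Longrightarrow> r = p"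
proof -
  define A where "A = {p. sublinear p \<and> p \<le> q}"
  \<comment> \<open>The order is reversed because \<open>predicate_Zorn\<close> returns a maximal
    element.\<close>
  define P where "P p r \<longleftrightarrow> r \<le> p" for p r :: "'a \<Rightarrow> real"
  have po: "partial_order_on A (relation_of P A)"
    by (rule partial_order_on_relation_ofI) (auto simp: P_def)
  have "\<exists>u\<in>A. \<forall>p\<in>C. P p u" if C: "C \<in> Chains (relation_of P A)" for C
  proof (cases "C = {}")
    case True
    then show ?thesis using q by (auto simp: A_def)
  next
    case ne: False
    have CA: "sublinear p" "p x \<le> q x" if "p \<in> C" for p x
      using C that by (auto simp: Chains_def relation_of_def A_def le_fun_def)
    have chain: "p \<le> r \<or> r \<le> p" if "p \<in> C" "r \<in> C" for p r
      using C that by (auto simp: Chains_def relation_of_def P_def)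
    define u where "u x = (INF p\<in>C. p x)" for x
    have bdd: "bdd_below ((\<lambda>p. p x) ` C)" for x
    proof (rule bdd_belowI2)
      fix p assume "p \<in> C"
      then show "- q (- x) \<le> p x" using sublinear_neg[OF CA(1), of p x] CA(2)[of p "- x"] by simp
    qed
    have upper: "u x \<le> p x" if "p \<in> C" for p x
      unfolding u_def by (rule cINF_lower[OF bdd that])
    have greatest: "a \<le> u x" if "\<And>p. p \<in> C \<Longrightarrow> a \<le> p x" for a x
      unfolding u_def by (rule cINF_greatest[OF ne that])
    have "sublinear u"
      unfolding sublinear_def
    proof (intro conjI allI impI)
      fix x y
      have "u (x + y) \<le> r y + p x" if pr: "p \<in> C" "r \<in> C" for p r
      proof -
        \<comment> \<open>Comparability in the chain enters here: nearly optimal members at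
          \<open>x\<close> and at \<open>y\<close> may differ, and the smaller of the two serves
          both points.\<close>
        obtain s where s: "s \<in> C" "s \<le> p" "s \<le> r" using chain[OF pr] pr by blast
        have "u (x + y) \<le> s x + s y"
          using upper[OF s(1), of "x + y"] sublinear_add[OF CA(1)[OF s(1)], of x y] by simp
        also have "\<dots> \<le> p x + r y" using s by (intro add_mono) (auto simp: le_fun_def)
        finally show ?thesis by (simp only: add.commute)
      qed
      then have "u (x + y) - p x \<le> u y" if "p \<in> C" for p
        by (intro greatest) (use that in \<open>simp add: diff_le_eq\<close>)
      then have "u (x + y) - u y \<le> u x" by (intro greatest) (simp add: diff_le_eq add.commute)
      then show "u (x + y) \<le> u x + u y" by simp
    next
      fix t :: real and x assume t: "t \<ge> 0"
      have le: "u (t *\<^sub>R x) \<le> t * p x" if "p \<in> C" for p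
        using upper[OF that, of "t *\<^sub>R x"] sublinear_scale_le[OF CA(1)[OF that] t, of x] by simp
      show "u (t *\<^sub>R x) \<le> t * u x"
      proof (cases "t = 0")
        case True
        then show ?thesis using le ne by auto
      next
        case False
        with t have t: "t > 0" by simp
        have "u (t *\<^sub>R x) / t \<le> u x"
          by (intro greatest) (use le t in \<open>simp add: field_simps\<close>)
        then show ?thesis using t by (simp add: field_simps)
      qed
    qed
    moreover have "u \<le> q"
      using ne upper CA(2) by (metis (no_types, lifting) all_not_in_conv le_funI order_trans)
    ultimately have "u \<in> A" by (simp add: A_def)
    then show ?thesis using upper by (auto simp: P_def le_fun_def)
  qed
  from predicate_Zorn[OF po this] obtain p where p: "p \<in> A" "\<forall>r\<in>A. P p r \<longrightarrow> r = p" by blast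
  show ?thesis
  proof
    show "sublinear p" "\<And>x. p x \<le> q x" using p(1) by (auto simp: A_def le_fun_def)
    show "r = p" if "sublinear r" "\<And>x. r x \<le> p x" for r
      using p that by (auto simp: A_def P_def le_fun_def intro: order_trans)
  qed
qed

text \<open>Tilting the norm at \<open>x\<close> before minimising builds the norming property into
  the upper bound: at \<open>- x\<close> the tilted functional is at most \<open>- norm x\<close>,
  and this survives for every \<open>p\<close> below it. Minimality makes \<open>p\<close> additive,
  hence odd and linear, so \<open>p x = norm x\<close>.\<close>

lemma ex_norming_functional:
  fixes x :: "'a::real_normed_vector"
  shows "\<exists>\<phi> :: 'a \<Rightarrow>\<^sub>L real. norm \<phi> \<le> 1 \<and> blinfun_apply \<phi> x = norm x"
proof -
  have "sublinear (norm :: 'a \<Rightarrow> real)"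
    by (simp add: sublinear_def norm_triangle_ineq)
  then obtain q where q: "sublinear q" "\<And>z. q z \<le> norm z" "\<And>z. q z \<le> norm (z + x) - norm x"
    using sublinear_tilt[of norm x] by blast
  obtain p where p: "sublinear p" and pq: "\<And>z. p z \<le> q z"
    and min: "\<And>r. sublinear r \<Longrightarrow> (\<And>z. r z \<le> p z) \<Longrightarrow> r = p"
    using minimal_sublinear_below[OF q(1)] by metis
  have add: "p (a + b) = p a + p b" for a b
  proof -
    \<comment> \<open>The tilt of \<open>p\<close> at \<open>b\<close> lies below \<open>p\<close>,
      hence equals \<open>p\<close> by minimality; its second bound then reads
      \<open>p a \<le> p (a + b) - p b\<close>.\<close>
    obtain r where "sublinear r" "\<And>z. r z \<le> p z" "\<And>z. r z \<le> p (z + b) - p b"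
      using sublinear_tilt[OF p] by blast
    with min have "p a \<le> p (a + b) - p b" by metis
    with sublinear_add[OF p, of a b] show ?thesis by simp
  qed
  have neg: "p (- a) = - p a" for a
    using add[of a "- a"] sublinear_zero[OF p] by simp
  have scale: "p (t *\<^sub>R a) = t * p a" for t a
  proof (cases "t \<ge> 0")
    case False
    then have "p (t *\<^sub>R a) = p (- ((- t) *\<^sub>R a))" by simp
    also have "\<dots> = t * p a" using False sublinear_scale[OF p, of "- t" a] by (simp only: neg)
    finally show ?thesis .
  qed (rule sublinear_scale[OF p])
  have le: "p a \<le> norm a" for a using pq q(2) order_trans by blast
  have abs_le: "\<bar>p a\<bar> \<le> norm a" for a using le[of a] le[of "- a"] neg[of a] by auto
  have bl: "bounded_linear p"
    by (rule bounded_linear_intro[where K = 1]) (simp_all add: add scale abs_le)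
  define \<phi> where "\<phi> = Blinfun p"
  have \<phi>: "blinfun_apply \<phi> = p" unfolding \<phi>_def by (rule bounded_linear_Blinfun_apply[OF bl])
  have "norm \<phi> \<le> 1" by (rule norm_blinfun_bound) (use abs_le \<phi> in auto)
  moreover have "p (- x) \<le> - norm x" using pq[of "- x"] q(3)[of "- x"] by simp
  then have "p x = norm x" using neg[of x] le[of x] by simp
  ultimately show ?thesis using \<phi> by auto
qed

section \<open>Equality cases under strict convexity\<close>

lemma abs_blinfun_le_norm:
  fixes \<phi> :: "'a::real_normed_vector \<Rightarrow>\<^sub>L real"
  assumes "norm \<phi> \<le> 1"
  shows "\<bar>blinfun_apply \<phi> x\<bar> \<le> norm x"
  using norm_blinfun[of \<phi> x] mult_right_mono[OF assms norm_ge_zero[of x]] by simp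

lemma blinfun_eq_norm_iff_sgn:
  fixes \<phi> :: "'a::real_normed_vector \<Rightarrow>\<^sub>L real"
  assumes "x \<noteq> 0"
  shows "blinfun_apply \<phi> x = norm x \<longleftrightarrow> blinfun_apply \<phi> (sgn x) = 1"
  using assms by (auto simp: sgn_div_norm blinfun.scaleR_right field_simps)

text \<open>A functional of norm at most 1 with value 1 at both unit vectors has value 2 at their
  sum, whose norm is then at least 2; strict convexity forbids this for distinct unit
  vectors.\<close>

lemma strictly_convex_sgn_unique:
  fixes x x' :: "'a::real_normed_vector"
  assumes sc: "strictly_convex_space TYPE('a)" and \<phi>: "norm (\<phi> :: 'a \<Rightarrow>\<^sub>L real) \<le> 1"
    and x: "x \<noteq> 0" "blinfun_apply \<phi> x = norm x" and x': "x' \<noteq> 0" "blinfun_apply \<phi> x' = norm x'"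
  shows "sgn x = sgn x'"
proof (rule ccontr)
  assume "sgn x \<noteq> sgn x'"
  then have "norm (sgn x + sgn x') < 2"
    using sc x(1) x'(1) by (simp add: strictly_convex_space_def norm_sgn)
  moreover have "blinfun_apply \<phi> (sgn x + sgn x') = 2"
    using x x' by (simp add: blinfun.add_right blinfun_eq_norm_iff_sgn)
  ultimately show False using abs_blinfun_le_norm[OF \<phi>, of "sgn x + sgn x'"] by simp
qed

text \<open>A functional norming the sum norms every term, since there is no slack in
  \<open>\<phi> (\<Sum>i. z i) \<le> (\<Sum>i. norm (z i))\<close>.\<close>

lemma strictly_convex_sums_sgn:
  fixes z :: "nat \<Rightarrow> 'a::real_normed_vector"
  assumes sc: "strictly_convex_space TYPE('a)"
    and z: "z sums x" and norms: "(\<lambda>i. norm (z i)) sums norm x" and nz: "x \<noteq> 0" "z i \<noteq> 0"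
  shows "sgn (z i) = sgn x"
proof -
  obtain \<phi> :: "'a \<Rightarrow>\<^sub>L real" where \<phi>: "norm \<phi> \<le> 1" "blinfun_apply \<phi> x = norm x"
    using ex_norming_functional by blast
  have "(\<lambda>i. blinfun_apply \<phi> (z i)) sums norm x"
    using bounded_linear.sums[OF blinfun.bounded_linear_right z] \<phi>(2) by metis
  from sums_diff[OF norms this] have s: "(\<lambda>i. norm (z i) - blinfun_apply \<phi> (z i)) sums 0" by simp
  have nn: "norm (z i) - blinfun_apply \<phi> (z i) \<ge> 0" for i
    using abs_blinfun_le_norm[OF \<phi>(1), of "z i"] by simp
  have "norm (z i) - blinfun_apply \<phi> (z i) = 0"
    using suminf_eq_zero_iff[OF sums_summable[OF s] nn] sums_unique[OF s] by simp
  then show ?thesis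
    by (intro strictly_convex_sgn_unique[OF sc \<phi>(1)]) (use nz \<phi> in auto)
qed

section \<open>Strong measurability and the Bochner integral\<close>

lemma strongly_measurable_simple: "simple_function M f \<Longrightarrow> strongly_measurable M f"
  unfolding strongly_measurable_def by (rule exI[of _ "\<lambda>_. f"]) simp

text \<open>The third assumption is joint sequential continuity of \<open>h\<close>, which carries
  the pointwise limits of simple functions through. Unary operations are covered by an
  \<open>h\<close> that ignores one argument.\<close>

lemma strongly_measurable_compose2:
  assumes "strongly_measurable M f" "strongly_measurable M g"
    and "\<And>X Y x y. X \<longlonglongrightarrow> x \<Longrightarrow> Y \<longlonglongrightarrow> y \<Longrightarrow> (\<lambda>i. h (X i) (Y i)) \<longlonglongrightarrow> h x y"
  shows "strongly_measurable M (\<lambda>\<omega>. h (f \<omega>) (g \<omega>))"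
proof -
  obtain s t where "\<forall>i. simple_function M (s i)" "\<forall>\<omega>\<in>space M. (\<lambda>i. s i \<omega>) \<longlonglongrightarrow> f \<omega>"
    and "\<forall>i. simple_function M (t i)" "\<forall>\<omega>\<in>space M. (\<lambda>i. t i \<omega>) \<longlonglongrightarrow> g \<omega>"
    using assms(1,2) unfolding strongly_measurable_def by blast
  then show ?thesis
    unfolding strongly_measurable_def
    by (intro exI[of _ "\<lambda>i \<omega>. h (s i \<omega>) (t i \<omega>)"])
      (auto intro!: simple_function_compose2[where h = h] assms(3))
qed

lemma strongly_measurable_add:
  fixes f g :: "'a \<Rightarrow> 'b::real_normed_vector"
  shows "strongly_measurable M f \<Longrightarrow> strongly_measurable M g \<Longrightarrow>
    strongly_measurable M (\<lambda>\<omega>. f \<omega> + g \<omega>)"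
  by (rule strongly_measurable_compose2) (auto intro: tendsto_intros)

lemma strongly_measurable_diff:
  fixes f g :: "'a \<Rightarrow> 'b::real_normed_vector"
  shows "strongly_measurable M f \<Longrightarrow> strongly_measurable M g \<Longrightarrow>
    strongly_measurable M (\<lambda>\<omega>. f \<omega> - g \<omega>)"
  by (rule strongly_measurable_compose2) (auto intro: tendsto_intros)

lemma strongly_measurable_scaleR:
  fixes f :: "'a \<Rightarrow> 'b::real_normed_vector"
  shows "strongly_measurable M c \<Longrightarrow> strongly_measurable M f \<Longrightarrow>
    strongly_measurable M (\<lambda>\<omega>. c \<omega> *\<^sub>R f \<omega>)"
  by (rule strongly_measurable_compose2) (auto intro: tendsto_intros)

lemma strongly_measurable_blinfun_apply:
  fixes f :: "'a \<Rightarrow> 'b::real_normed_vector" and g :: "'a \<Rightarrow> 'b \<Rightarrow>\<^sub>L 'c::real_normed_vector"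
  shows "strongly_measurable M g \<Longrightarrow> strongly_measurable M f \<Longrightarrow>
    strongly_measurable M (\<lambda>\<omega>. blinfun_apply (g \<omega>) (f \<omega>))"
  by (rule strongly_measurable_compose2) (auto intro: tendsto_intros)

lemma strongly_measurable_sum:
  fixes f :: "'i \<Rightarrow> 'a \<Rightarrow> 'b::real_normed_vector"
  shows "(\<And>i. i \<in> I \<Longrightarrow> strongly_measurable M (f i)) \<Longrightarrow>
    strongly_measurable M (\<lambda>\<omega>. \<Sum>i\<in>I. f i \<omega>)"
proof (induction I rule: infinite_finite_induct)
  case (insert i I)
  then show ?case using strongly_measurable_add[of M "f i" "\<lambda>\<omega>. \<Sum>i\<in>I. f i \<omega>"] by simp
qed (simp_all add: strongly_measurable_simple)

lemma borel_measurable_strongly_measurable: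
  fixes f :: "'a \<Rightarrow> 'b::metric_space"
  assumes "strongly_measurable M f"
  shows "f \<in> borel_measurable M"
proof -
  obtain s where s: "\<forall>i. simple_function M (s i)" "\<forall>\<omega>\<in>space M. (\<lambda>i. s i \<omega>) \<longlonglongrightarrow> f \<omega>"
    using assms unfolding strongly_measurable_def by blast
  show ?thesis
    by (rule borel_measurable_LIMSEQ_metric[where f = s])
      (use s in \<open>auto intro: borel_measurable_simple_function\<close>)
qed

lemma strongly_measurable_borel:
  fixes f :: "'a \<Rightarrow> real"
  assumes "f \<in> borel_measurable M"
  shows "strongly_measurable M f"
  using borel_measurable_implies_sequence_metric[OF assms, of 0]
  unfolding strongly_measurable_def by auto

lemma borel_measurable_norm_strong:
  fixes f :: "'a \<Rightarrow> 'b::real_normed_vector"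
  assumes "strongly_measurable M f"
  shows "(\<lambda>\<omega>. norm (f \<omega>)) \<in> borel_measurable M"
  by (rule borel_measurable_strongly_measurable
      [OF strongly_measurable_compose2[OF assms assms, where h = "\<lambda>x y. norm x"]])
    (rule tendsto_norm)

lemma strongly_measurable_sgn:
  fixes f :: "'a \<Rightarrow> 'b::real_normed_vector"
  assumes f: "strongly_measurable M f"
  shows "strongly_measurable M (\<lambda>\<omega>. sgn (f \<omega>))"
proof -
  have "(\<lambda>\<omega>. inverse (norm (f \<omega>))) \<in> borel_measurable M"
    using borel_measurable_norm_strong[OF f] by simp
  from strongly_measurable_scaleR[OF strongly_measurable_borel[OF this] f]
  show ?thesis by (simp add: sgn_div_norm)
qed

lemma strongly_measurable_indicator:
  fixes f :: "'a \<Rightarrow> 'b::real_normed_vector"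
  shows "A \<in> sets M \<Longrightarrow> strongly_measurable M f \<Longrightarrow>
    strongly_measurable M (\<lambda>\<omega>. indicator A \<omega> *\<^sub>R f \<omega>)"
  by (intro strongly_measurable_scaleR strongly_measurable_borel) simp_all

section \<open>The Bochner integral tested against functionals\<close>

lemma tendsto_nn_integral_le_zero:
  assumes "(\<lambda>i. \<integral>\<^sup>+\<omega>. f i \<omega> \<partial>M) \<longlonglongrightarrow> 0" and "\<And>i \<omega>. \<omega> \<in> space M \<Longrightarrow> g i \<omega> \<le> f i \<omega>"
  shows "(\<lambda>i. \<integral>\<^sup>+\<omega>. g i \<omega> \<partial>M) \<longlonglongrightarrow> 0"
  by (rule tendsto_sandwich[OF _ _ tendsto_const assms(1)])
    (auto intro!: always_eventually nn_integral_mono assms(2))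

lemma simple_bochner_integrable_functional:
  fixes s :: "'a \<Rightarrow> 'b::real_normed_vector" and \<phi> :: "'b \<Rightarrow>\<^sub>L real"
  shows "Bochner_Integration.simple_bochner_integrable M s \<Longrightarrow>
    Bochner_Integration.simple_bochner_integrable M (\<lambda>\<omega>. blinfun_apply \<phi> (s \<omega>))"
  using simple_bochner_integrable_compose2[of "\<lambda>x y. blinfun_apply \<phi> x" M s s] by simp

lemma simple_bochner_integral_functional:
  fixes s :: "'a \<Rightarrow> 'b::real_normed_vector" and \<phi> :: "'b \<Rightarrow>\<^sub>L real"
  shows "Bochner_Integration.simple_bochner_integrable M s \<Longrightarrow>
    Bochner_Integration.simple_bochner_integral M (\<lambda>\<omega>. blinfun_apply \<phi> (s \<omega>)) =
    blinfun_apply \<phi> (Bochner_Integration.simple_bochner_integral M s)"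
  by (intro simple_bochner_integral_linear bounded_linear.linear blinfun.bounded_linear_right)

lemma borel_measurable_functional:
  fixes f :: "'a \<Rightarrow> 'b::real_normed_vector" and \<phi> :: "'b \<Rightarrow>\<^sub>L real"
  shows "strongly_measurable M f \<Longrightarrow> (\<lambda>\<omega>. blinfun_apply \<phi> (f \<omega>)) \<in> borel_measurable M"
  by (intro borel_measurable_strongly_measurable strongly_measurable_blinfun_apply
      strongly_measurable_simple[OF simple_function_const])

text \<open>The images of the approximating simple functions approximate the image of
  \<open>f\<close>, with errors no larger since \<open>norm \<phi> \<le> 1\<close>. This is the
  bridge from vector integrals to the scalar theory.\<close>

lemma has_strong_bochner_integral_functional:
  fixes f :: "'a \<Rightarrow> 'b::real_normed_vector" and \<phi> :: "'b \<Rightarrow>\<^sub>L real"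
  assumes "has_strong_bochner_integral M f x" and \<phi>: "norm \<phi> \<le> 1"
  shows "has_bochner_integral M (\<lambda>\<omega>. blinfun_apply \<phi> (f \<omega>)) (blinfun_apply \<phi> x)"
proof -
  obtain s where f: "strongly_measurable M f"
    and s: "\<And>i. Bochner_Integration.simple_bochner_integrable M (s i)"
    and lim: "(\<lambda>i. \<integral>\<^sup>+\<omega>. ennreal (norm (f \<omega> - s i \<omega>)) \<partial>M) \<longlonglongrightarrow> 0"
    and x: "(\<lambda>i. Bochner_Integration.simple_bochner_integral M (s i)) \<longlonglongrightarrow> x"
    using assms(1) unfolding has_strong_bochner_integral_def by blast
  show ?thesis
  proof (rule has_bochner_integral.intros[where s = "\<lambda>i \<omega>. blinfun_apply \<phi> (s i \<omega>)"])
    show "(\<lambda>\<omega>. blinfun_apply \<phi> (f \<omega>)) \<in> borel_measurable M"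
      by (rule borel_measurable_functional[OF f])
    show "\<And>i. Bochner_Integration.simple_bochner_integrable M (\<lambda>\<omega>. blinfun_apply \<phi> (s i \<omega>))"
      by (rule simple_bochner_integrable_functional[OF s])
    show "(\<lambda>i. \<integral>\<^sup>+\<omega>. ennreal (norm (blinfun_apply \<phi> (f \<omega>) - blinfun_apply \<phi> (s i \<omega>))) \<partial>M)
        \<longlonglongrightarrow> 0"
      by (rule tendsto_nn_integral_le_zero[OF lim])
        (use abs_blinfun_le_norm[OF \<phi>] in \<open>simp add: blinfun.diff_right[symmetric] ennreal_leI\<close>)
    show "(\<lambda>i. Bochner_Integration.simple_bochner_integral M (\<lambda>\<omega>. blinfun_apply \<phi> (s i \<omega>)))
        \<longlonglongrightarrow> blinfun_apply \<phi> x"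
      using s by (simp add: simple_bochner_integral_functional tendsto_intros x)
  qed
qed

text \<open>A functional norming \<open>x - x'\<close> takes the same value at both vectors, namely
  one scalar integral, so \<open>norm (x - x') = 0\<close>. This also justifies the definite
  description in \<open>bochner_integral\<close>.\<close>

lemma has_strong_bochner_integral_unique:
  fixes f :: "'a \<Rightarrow> 'b::real_normed_vector"
  assumes "has_strong_bochner_integral M f x" "has_strong_bochner_integral M f x'"
  shows "x = x'"
proof -
  obtain \<phi> :: "'b \<Rightarrow>\<^sub>L real" where \<phi>: "norm \<phi> \<le> 1" "blinfun_apply \<phi> (x - x') = norm (x - x')"
    using ex_norming_functional by blast
  have "blinfun_apply \<phi> x = blinfun_apply \<phi> x'"
    using assms has_strong_bochner_integral_functional[OF _ \<phi>(1)] has_bochner_integral_eq by blast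
  then show ?thesis using \<phi>(2) by (simp add: blinfun.diff_right)
qed

lemma bochner_integral_functional:
  fixes f :: "'a \<Rightarrow> 'b::real_normed_vector" and \<phi> :: "'b \<Rightarrow>\<^sub>L real"
  assumes "bochner_integrable M f" "norm \<phi> \<le> 1"
  shows "has_bochner_integral M (\<lambda>\<omega>. blinfun_apply \<phi> (f \<omega>)) (blinfun_apply \<phi> (bochner_integral M f))"
proof -
  obtain x where x: "has_strong_bochner_integral M f x"
    using assms(1) unfolding bochner_integrable_def by blast
  then have "bochner_integral M f = x"
    unfolding bochner_integral_def using has_strong_bochner_integral_unique by blast
  with has_strong_bochner_integral_functional[OF x assms(2)] show ?thesis by simp
qed

text \<open>A functional norming the difference of the two integrals reduces the estimate to its
  scalar version.\<close>

lemma simple_bochner_integral_dist: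
  fixes f :: "'a \<Rightarrow> 'b::real_normed_vector"
  assumes f: "strongly_measurable M f"
    and s: "Bochner_Integration.simple_bochner_integrable M s"
    and t: "Bochner_Integration.simple_bochner_integrable M t"
  shows "ennreal (norm (Bochner_Integration.simple_bochner_integral M s
      - Bochner_Integration.simple_bochner_integral M t)) \<le>
    (\<integral>\<^sup>+\<omega>. ennreal (norm (f \<omega> - s \<omega>)) \<partial>M) + (\<integral>\<^sup>+\<omega>. ennreal (norm (f \<omega> - t \<omega>)) \<partial>M)"
    (is "ennreal (norm (?s - ?t)) \<le> _")
proof -
  obtain \<phi> :: "'b \<Rightarrow>\<^sub>L real" where \<phi>: "norm \<phi> \<le> 1" "blinfun_apply \<phi> (?s - ?t) = norm (?s - ?t)"
    using ex_norming_functional by blast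
  have "ennreal (norm (?s - ?t)) =
      ennreal (norm (blinfun_apply \<phi> ?s - blinfun_apply \<phi> ?t))"
    using \<phi>(2) by (simp add: blinfun.diff_right)
  also have "\<dots> \<le> (\<integral>\<^sup>+\<omega>. ennreal (norm (blinfun_apply \<phi> (f \<omega>) - blinfun_apply \<phi> (s \<omega>))) \<partial>M)
      + (\<integral>\<^sup>+\<omega>. ennreal (norm (blinfun_apply \<phi> (f \<omega>) - blinfun_apply \<phi> (t \<omega>))) \<partial>M)"
    using simple_bochner_integral_bounded[OF borel_measurable_functional[OF f]
      simple_bochner_integrable_functional[OF s] simple_bochner_integrable_functional[OF t]]
    by (simp only: simple_bochner_integral_functional[OF s] simple_bochner_integral_functional[OF t])
  also have "\<dots> \<le> (\<integral>\<^sup>+\<omega>. ennreal (norm (f \<omega> - s \<omega>)) \<partial>M) + (\<integral>\<^sup>+\<omega>. ennreal (norm (f \<omega> - t \<omega>)) \<partial>M)"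
    using abs_blinfun_le_norm[OF \<phi>(1)]
    by (intro add_mono nn_integral_mono) (simp_all add: blinfun.diff_right[symmetric] ennreal_leI)
  finally show ?thesis .
qed

text \<open>The integrals of the approximants are Cauchy by the distance estimate, and completeness
  supplies the value, so no candidate for the integral has to be named.\<close>

lemma bochner_integrable_approxI:
  fixes f :: "'a \<Rightarrow> 'b::banach"
  assumes f: "strongly_measurable M f"
    and s: "\<And>i. Bochner_Integration.simple_bochner_integrable M (s i)"
    and lim: "(\<lambda>i. \<integral>\<^sup>+\<omega>. ennreal (norm (f \<omega> - s i \<omega>)) \<partial>M) \<longlonglongrightarrow> 0"
  shows "bochner_integrable M f"
proof -
  let ?S = "\<lambda>i. Bochner_Integration.simple_bochner_integral M (s i)"
  have "Cauchy ?S"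
  proof (rule metric_CauchyI)
    fix e :: real assume e: "e > 0"
    then have "eventually (\<lambda>i. (\<integral>\<^sup>+\<omega>. ennreal (norm (f \<omega> - s i \<omega>)) \<partial>M) < ennreal (e / 2)) sequentially"
      by (intro order_tendstoD(2)[OF lim]) simp
    then obtain N where N: "\<And>i. i \<ge> N \<Longrightarrow> (\<integral>\<^sup>+\<omega>. ennreal (norm (f \<omega> - s i \<omega>)) \<partial>M) < ennreal (e / 2)"
      unfolding eventually_sequentially by blast
    have "dist (?S m) (?S n) < e" if "m \<ge> N" "n \<ge> N" for m n
    proof -
      have "ennreal (norm (?S m - ?S n)) < ennreal (e / 2) + ennreal (e / 2)"
        using simple_bochner_integral_dist[OF f s[of m] s[of n]] add_strict_mono[OF N[OF that(1)] N[OF that(2)]]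
        by (rule le_less_trans)
      also have "\<dots> = ennreal e" using e by (simp flip: ennreal_plus)
      finally show ?thesis using e by (simp add: dist_norm ennreal_less_iff)
    qed
    then show "\<exists>N. \<forall>m\<ge>N. \<forall>n\<ge>N. dist (?S m) (?S n) < e" by blast
  qed
  then show ?thesis
    using assms unfolding bochner_integrable_def has_strong_bochner_integral_def
    by (auto simp: Cauchy_convergent_iff convergent_def)
qed

lemma bochner_integrable_strongly_measurable:
  "bochner_integrable M f \<Longrightarrow> strongly_measurable M f"
  by (auto simp: bochner_integrable_def has_strong_bochner_integral_def)

lemma bochner_integrableE:
  assumes "bochner_integrable M f"
  obtains s where "\<And>i. Bochner_Integration.simple_bochner_integrable M (s i)"
    "(\<lambda>i. \<integral>\<^sup>+\<omega>. ennreal (norm (f \<omega> - s i \<omega>)) \<partial>M) \<longlonglongrightarrow> 0"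
  using assms by (auto simp: bochner_integrable_def has_strong_bochner_integral_def)

lemma bochner_integrable_indicator:
  fixes f :: "'a \<Rightarrow> 'b::banach"
  assumes f: "bochner_integrable M f" and A: "A \<in> sets M"
  shows "bochner_integrable M (\<lambda>\<omega>. indicator A \<omega> *\<^sub>R f \<omega>)"
proof -
  obtain s where s: "\<And>i. Bochner_Integration.simple_bochner_integrable M (s i)"
    and lim: "(\<lambda>i. \<integral>\<^sup>+\<omega>. ennreal (norm (f \<omega> - s i \<omega>)) \<partial>M) \<longlonglongrightarrow> 0"
    using bochner_integrableE[OF f] by metis
  show ?thesis
  proof (rule bochner_integrable_approxI[where s = "\<lambda>i \<omega>. indicator A \<omega> *\<^sub>R s i \<omega>"])
    show "strongly_measurable M (\<lambda>\<omega>. indicator A \<omega> *\<^sub>R f \<omega>)"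
      by (intro strongly_measurable_indicator A bochner_integrable_strongly_measurable[OF f])
    show "Bochner_Integration.simple_bochner_integrable M (\<lambda>\<omega>. indicator A \<omega> *\<^sub>R s i \<omega>)" for i
    proof
      have si: "simple_function M (s i)" "emeasure M {\<omega> \<in> space M. s i \<omega> \<noteq> 0} \<noteq> \<infinity>"
        using s[of i] by (auto elim: simple_bochner_integrable.cases)
      show "simple_function M (\<lambda>\<omega>. indicator A \<omega> *\<^sub>R s i \<omega>)"
        using A si(1) by (intro simple_function_compose2[where h = "(*\<^sub>R)"]) auto
      have "{\<omega> \<in> space M. s i \<omega> \<noteq> 0} = s i -` (- {0}) \<inter> space M" by auto
      then have "{\<omega> \<in> space M. s i \<omega> \<noteq> 0} \<in> sets M" using simple_functionD(2)[OF si(1)] by metis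
      then have "emeasure M {\<omega> \<in> space M. indicator A \<omega> *\<^sub>R s i \<omega> \<noteq> 0} \<le> emeasure M {\<omega> \<in> space M. s i \<omega> \<noteq> 0}"
        by (intro emeasure_mono) auto
      then show "emeasure M {\<omega> \<in> space M. indicator A \<omega> *\<^sub>R s i \<omega> \<noteq> 0} \<noteq> \<infinity>"
        using si(2) by (auto simp: top_unique)
    qed
    show "(\<lambda>i. \<integral>\<^sup>+\<omega>. ennreal (norm (indicator A \<omega> *\<^sub>R f \<omega> - indicator A \<omega> *\<^sub>R s i \<omega>)) \<partial>M) \<longlonglongrightarrow> 0"
      by (rule tendsto_nn_integral_le_zero[OF lim]) (auto split: split_indicator)
  qed
qed

lemma bochner_integrable_norm:
  fixes f :: "'a \<Rightarrow> 'b::real_normed_vector"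
  assumes f: "bochner_integrable M f"
  shows "integrable M (\<lambda>\<omega>. norm (f \<omega>))"
proof -
  obtain s where s: "\<And>i. Bochner_Integration.simple_bochner_integrable M (s i)"
    and lim: "(\<lambda>i. \<integral>\<^sup>+\<omega>. ennreal (norm (f \<omega> - s i \<omega>)) \<partial>M) \<longlonglongrightarrow> 0"
    using bochner_integrableE[OF f] by metis
  have "has_bochner_integral M (\<lambda>\<omega>. norm (s i \<omega>))
      (Bochner_Integration.simple_bochner_integral M (\<lambda>\<omega>. norm (s i \<omega>)))" for i
    using simple_bochner_integrable_compose2[of "\<lambda>x y. norm x" M "s i" "s i"] s
    by (intro has_bochner_integral_simple_bochner_integrable) simp
  then have ns: "integrable M (\<lambda>\<omega>. norm (s i \<omega>))" for i
    by (auto simp: has_bochner_integral_iff)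
  have fm: "strongly_measurable M f" by (rule bochner_integrable_strongly_measurable[OF f])
  have sm: "strongly_measurable M (s i)" for i
    using s[of i] by (auto elim!: simple_bochner_integrable.cases intro: strongly_measurable_simple)
  have [measurable]: "(\<lambda>\<omega>. norm (f \<omega>)) \<in> borel_measurable M"
    "(\<lambda>\<omega>. norm (f \<omega> - s i \<omega>)) \<in> borel_measurable M" "(\<lambda>\<omega>. norm (s i \<omega>)) \<in> borel_measurable M" for i
    by (intro borel_measurable_norm_strong strongly_measurable_diff fm sm)+
  \<comment> \<open>A single approximant at finite distance suffices; the bound 1 is
    arbitrary.\<close>
  obtain i where i: "(\<integral>\<^sup>+\<omega>. ennreal (norm (f \<omega> - s i \<omega>)) \<partial>M) < 1"
    using order_tendstoD(2)[OF lim, of 1] by (auto simp: eventually_sequentially)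
  have "(\<integral>\<^sup>+\<omega>. ennreal (norm (norm (f \<omega>))) \<partial>M)
      \<le> (\<integral>\<^sup>+\<omega>. ennreal (norm (f \<omega> - s i \<omega>)) + ennreal (norm (s i \<omega>)) \<partial>M)"
    by (intro nn_integral_mono) (simp flip: ennreal_plus add: norm_triangle_sub add.commute)
  also have "\<dots> = (\<integral>\<^sup>+\<omega>. ennreal (norm (f \<omega> - s i \<omega>)) \<partial>M) + (\<integral>\<^sup>+\<omega>. ennreal (norm (s i \<omega>)) \<partial>M)"
    by (intro nn_integral_add) auto
  also have "\<dots> < \<infinity>"
    using ns[of i] i by (auto simp: integrable_iff_bounded less_top ennreal_add_eq_top
        dest: order.strict_trans[OF _ ennreal_one_less_top])
  finally show ?thesis by (intro integrableI_bounded) auto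
qed

lemma L1_norm_nonneg: "L1_norm M f \<ge> 0"
  by (simp add: L1_norm_def)

lemma integrable_norm_diff:
  fixes f g :: "'a \<Rightarrow> 'b::real_normed_vector"
  assumes f: "strongly_measurable M f" "integrable M (\<lambda>\<omega>. norm (f \<omega>))"
    and g: "strongly_measurable M g" "integrable M (\<lambda>\<omega>. norm (g \<omega>))"
  shows "integrable M (\<lambda>\<omega>. norm (f \<omega> - g \<omega>))"
  by (rule Bochner_Integration.integrable_bound[OF Bochner_Integration.integrable_add[OF f(2) g(2)]])
    (auto intro!: borel_measurable_norm_strong strongly_measurable_diff f g norm_triangle_ineq4)

lemma bochner_integrable_simple_approx:
  fixes f :: "'a \<Rightarrow> 'b::real_normed_vector"
  assumes f: "bochner_integrable M f" and e: "e > 0"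
  obtains s where "simple_function M s" "integrable M (\<lambda>\<omega>. norm (s \<omega>))"
    "integrable M (\<lambda>\<omega>. norm (f \<omega> - s \<omega>))" "L1_norm M (\<lambda>\<omega>. f \<omega> - s \<omega>) < e"
proof -
  obtain t where t: "\<And>i. Bochner_Integration.simple_bochner_integrable M (t i)"
    and lim: "(\<lambda>i. \<integral>\<^sup>+\<omega>. ennreal (norm (f \<omega> - t i \<omega>)) \<partial>M) \<longlonglongrightarrow> 0"
    using bochner_integrableE[OF f] by metis
  obtain i where i: "(\<integral>\<^sup>+\<omega>. ennreal (norm (f \<omega> - t i \<omega>)) \<partial>M) < ennreal e"
    using order_tendstoD(2)[OF lim, of "ennreal e"] e by (auto simp: eventually_sequentially)
  have simple: "simple_function M (t i)"
    using t[of i] by (auto elim: simple_bochner_integrable.cases)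
  have tm: "strongly_measurable M (t i)" by (rule strongly_measurable_simple[OF simple])
  have fm: "strongly_measurable M f" by (rule bochner_integrable_strongly_measurable[OF f])
  have "has_bochner_integral M (\<lambda>\<omega>. norm (t i \<omega>))
      (Bochner_Integration.simple_bochner_integral M (\<lambda>\<omega>. norm (t i \<omega>)))"
    using simple_bochner_integrable_compose2[of "\<lambda>x y. norm x" M "t i" "t i"] t
    by (intro has_bochner_integral_simple_bochner_integrable) simp
  then have nt: "integrable M (\<lambda>\<omega>. norm (t i \<omega>))"
    by (auto simp: has_bochner_integral_iff)
  have int: "integrable M (\<lambda>\<omega>. norm (f \<omega> - t i \<omega>))"
    by (rule integrable_norm_diff[OF fm bochner_integrable_norm[OF f] tm nt])
  have "ennreal (L1_norm M (\<lambda>\<omega>. f \<omega> - t i \<omega>)) = (\<integral>\<^sup>+\<omega>. ennreal (norm (f \<omega> - t i \<omega>)) \<partial>M)"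
    unfolding L1_norm_def by (rule nn_integral_eq_integral[symmetric, OF int]) simp
  with i e have "L1_norm M (\<lambda>\<omega>. f \<omega> - t i \<omega>) < e"
    using ennreal_less_iff[OF L1_norm_nonneg] by metis
  with simple nt int show ?thesis by (rule that)
qed

lemma indefinite_integral_functional:
  fixes u :: "'a \<Rightarrow> 'b::banach" and \<phi> :: "'b \<Rightarrow>\<^sub>L real"
  assumes u: "bochner_integrable M u" and A: "A \<in> sets M" and \<phi>: "norm \<phi> \<le> 1"
  shows "integrable M (\<lambda>\<omega>. indicator A \<omega> * blinfun_apply \<phi> (u \<omega>))"
    and "(\<integral>\<omega>. indicator A \<omega> * blinfun_apply \<phi> (u \<omega>) \<partial>M) = blinfun_apply \<phi> (indefinite_integral M u A)"
  using bochner_integral_functional[OF bochner_integrable_indicator[OF u A] \<phi>]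
  by (simp_all add: indefinite_integral_def has_bochner_integral_iff blinfun.scaleR_right)

lemma integrable_indicator_norm:
  fixes u :: "'a \<Rightarrow> 'b::real_normed_vector"
  assumes "integrable M (\<lambda>\<omega>. norm (u \<omega>))" and "A \<in> sets M"
  shows "integrable M (\<lambda>\<omega>. indicator A \<omega> * norm (u \<omega>))"
  using integrable_mult_indicator[OF assms(2,1)] by simp

text \<open>Move a functional norming the vector integral under the integral sign. The case of
  equality in this bound is what attainment of the total variation exploits.\<close>

lemma norm_indefinite_integral_le:
  fixes u :: "'a \<Rightarrow> 'b::banach"
  assumes u: "bochner_integrable M u" and A: "A \<in> sets M"
  shows "norm (indefinite_integral M u A) \<le> (\<integral>\<omega>. indicator A \<omega> * norm (u \<omega>) \<partial>M)"
proof -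
  obtain \<phi> :: "'b \<Rightarrow>\<^sub>L real" where \<phi>: "norm \<phi> \<le> 1"
      "blinfun_apply \<phi> (indefinite_integral M u A) = norm (indefinite_integral M u A)"
    using ex_norming_functional by blast
  have "norm (indefinite_integral M u A) = (\<integral>\<omega>. indicator A \<omega> * blinfun_apply \<phi> (u \<omega>) \<partial>M)"
    using indefinite_integral_functional(2)[OF u A \<phi>(1)] \<phi>(2) by simp
  also have "\<dots> \<le> (\<integral>\<omega>. indicator A \<omega> * norm (u \<omega>) \<partial>M)"
    using abs_blinfun_le_norm[OF \<phi>(1)]
    by (intro integral_mono indefinite_integral_functional(1)[OF u A \<phi>(1)]
        integrable_indicator_norm[OF bochner_integrable_norm[OF u] A])
      (auto split: split_indicator intro: order_trans[OF abs_ge_self])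
  finally show ?thesis .
qed

section \<open>Series of elementary tensors\<close>

lemma essentially_countably_valued_partition:
  fixes p :: "'a \<Rightarrow> 'b::t1_space"
  assumes p: "essentially_countably_valued M p"
  obtains N A y where "N \<in> null_sets M" "\<And>i::nat. A i \<in> sets M" "disjoint_family A"
    "(\<Union>i. A i) = space M - N" "\<And>i \<omega>. \<omega> \<in> A i \<Longrightarrow> p \<omega> = y i"
proof -
  obtain N where N: "N \<in> null_sets M" and C: "countable (p ` (space M - N))" (is "countable ?C")
    and pm: "p \<in> borel_measurable M"
    using p unfolding essentially_countably_valued_def by blast
  define A where "A i = {\<omega> \<in> space M - N. to_nat_on ?C (p \<omega>) = i}" for i
  define y where "y i = from_nat_into ?C i" for i
  have val: "p \<omega> = y i" if "\<omega> \<in> A i" for i \<omega>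
    using that C by (auto simp: A_def y_def)
  have "A i \<in> sets M" for i
  proof (cases "A i = {}")
    case False
    then obtain \<omega> where \<omega>: "\<omega> \<in> A i" by blast
    have "to_nat_on ?C (y i) = i"
      using \<omega> val[OF \<omega>] by (simp add: A_def)
    then have "x \<in> A i \<longleftrightarrow> x \<in> (p -` {y i} \<inter> space M) - N" for x
      using val[of x i] by (auto simp: A_def)
    then have Ai: "A i = (p -` {y i} \<inter> space M) - N" by (rule set_eqI)
    have "p -` {y i} \<inter> space M \<in> sets M"
      by (rule measurable_sets[OF pm]) simp
    with N show ?thesis unfolding Ai by (intro sets.Diff) auto
  qed simp
  moreover have "disjoint_family A" by (auto simp: disjoint_family_on_def A_def)
  moreover have "(\<Union>i. A i) = space M - N" by (auto simp: A_def)
  ultimately show ?thesis by (rule that[OF N _ _ _ val])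
qed

lemma essentially_countably_valuedI_AE:
  assumes m: "p \<in> borel_measurable M" and C: "countable C" and ae: "AE \<omega> in M. p \<omega> \<in> C"
  shows "essentially_countably_valued M p"
proof -
  obtain N where N: "N \<in> null_sets M" "{\<omega> \<in> space M. p \<omega> \<notin> C} \<subseteq> N"
    using ae by (auto simp: eventually_ae_filter)
  then have "p ` (space M - N) \<subseteq> C" by auto
  with m N(1) C show ?thesis
    unfolding essentially_countably_valued_def using countable_subset by blast
qed

lemma sums_indicator_disjoint_family:
  fixes v :: "nat \<Rightarrow> 'b::real_normed_vector"
  assumes "disjoint_family A" "\<omega> \<in> A k"
  shows "(\<lambda>i. indicator (A i) \<omega> *\<^sub>R v i) sums v k"
proof -
  have "(\<lambda>i. indicator (A i) \<omega> *\<^sub>R v i) = (\<lambda>i. if i = k then v i else 0)"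
    using assms by (auto simp: disjoint_family_on_def fun_eq_iff split: split_indicator)
  then show ?thesis using sums_single[of k v] by simp
qed

text \<open>Dominated convergence with the sum \<open>H\<close> itself as dominating function, since
  partial sums of nonnegative terms lie below it.\<close>

lemma integral_sums_nonneg:
  fixes h :: "nat \<Rightarrow> 'a \<Rightarrow> real"
  assumes h: "\<And>i. integrable M (h i)" and H: "integrable M H"
    and nn: "\<And>i. AE \<omega> in M. 0 \<le> h i \<omega>" and s: "AE \<omega> in M. (\<lambda>i. h i \<omega>) sums H \<omega>"
  shows "(\<lambda>i. \<integral>\<omega>. h i \<omega> \<partial>M) sums (\<integral>\<omega>. H \<omega> \<partial>M)"
proof -
  have nn': "AE \<omega> in M. \<forall>i. 0 \<le> h i \<omega>" using nn by (simp add: AE_all_countable)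
  have "(\<lambda>n. \<integral>\<omega>. (\<Sum>i<n. h i \<omega>) \<partial>M) \<longlonglongrightarrow> (\<integral>\<omega>. H \<omega> \<partial>M)"
  proof (rule integral_dominated_convergence[where w = H])
    show "AE \<omega> in M. (\<lambda>n. \<Sum>i<n. h i \<omega>) \<longlonglongrightarrow> H \<omega>" using s by (simp add: sums_def)
    show "AE \<omega> in M. norm (\<Sum>i<n. h i \<omega>) \<le> H \<omega>" for n
      using s nn'
    proof eventually_elim
      case (elim \<omega>)
      then show ?case
        using sum_le_suminf[of "\<lambda>i. h i \<omega>" "{..<n}"]
        by (simp add: sums_iff sum_nonneg)
    qed
  qed (use h H in \<open>auto intro!: borel_measurable_integrable\<close>)
  then show ?thesis using h by (simp add: sums_def)
qed

text \<open>Sum and integral commute in the extended nonnegative reals, so the pointwise sum has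
  finite integral and is finite almost everywhere.\<close>

lemma AE_summable_nonneg:
  fixes h :: "nat \<Rightarrow> 'a \<Rightarrow> real"
  assumes h: "\<And>i. integrable M (h i)" and nn: "\<And>i \<omega>. 0 \<le> h i \<omega>"
    and s: "summable (\<lambda>i. \<integral>\<omega>. h i \<omega> \<partial>M)"
  shows "AE \<omega> in M. summable (\<lambda>i. h i \<omega>)"
proof -
  have [measurable]: "h i \<in> borel_measurable M" for i using h by (rule borel_measurable_integrable)
  have "(\<integral>\<^sup>+\<omega>. (\<Sum>i. ennreal (h i \<omega>)) \<partial>M) = (\<Sum>i. \<integral>\<^sup>+\<omega>. ennreal (h i \<omega>) \<partial>M)"
    by (rule nn_integral_suminf) simp
  also have "\<dots> = (\<Sum>i. ennreal (\<integral>\<omega>. h i \<omega> \<partial>M))"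
    using h nn by (simp add: nn_integral_eq_integral)
  also have "\<dots> \<noteq> \<infinity>"
    using s nn by (simp add: ennreal_suminf_neq_top integral_nonneg)
  finally have "AE \<omega> in M. (\<Sum>i. ennreal (h i \<omega>)) \<noteq> \<infinity>"
    by (intro nn_integral_PInf_AE) auto
  then show ?thesis
    by eventually_elim (auto intro: summable_suminf_not_top nn)
qed

text \<open>Splitting \<open>w = norm w *\<^sub>R sgn w\<close> along the level sets of \<open>sgn w\<close> yields an optimal
  representation.\<close>

lemma radial_decomposition:
  fixes w :: "'a \<Rightarrow> 'b::real_normed_vector"
  assumes w: "integrable M (\<lambda>\<omega>. norm (w \<omega>))"
    and c: "essentially_countably_valued M (\<lambda>\<omega>. sgn (w \<omega>))"
  obtains f y where "\<And>i::nat. integrable M (f i)"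
    "\<And>i j. i \<noteq> j \<Longrightarrow> supp_on M (f i) \<inter> supp_on M (f j) = {}"
    "AE \<omega> in M. (\<lambda>i. f i \<omega> *\<^sub>R y i) sums w \<omega>"
    "AE \<omega> in M. (\<lambda>i. norm (f i \<omega> *\<^sub>R y i)) sums norm (w \<omega>)"
    "(\<lambda>i. L1_norm M (f i) * norm (y i)) sums L1_norm M w"
proof -
  obtain N A y where N: "N \<in> null_sets M" and A: "\<And>i::nat. A i \<in> sets M" "disjoint_family A"
    and UA: "(\<Union>i. A i) = space M - N" and val: "\<And>i \<omega>. \<omega> \<in> A i \<Longrightarrow> sgn (w \<omega>) = y i"
    using essentially_countably_valued_partition[OF c] by metis
  define f where "f i \<omega> = indicator (A i) \<omega> * norm (w \<omega>)" for i \<omega>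
  have f: "integrable M (f i)" for i
    unfolding f_def by (rule integrable_indicator_norm[OF w A(1)])
  have disj: "supp_on M (f i) \<inter> supp_on M (f j) = {}" if "i \<noteq> j" for i j
    using disjoint_family_onD[OF A(2) _ _ that] by (auto simp: supp_on_def f_def split: split_indicator_asm)
  have level: "f i \<omega> *\<^sub>R y i = indicator (A i) \<omega> *\<^sub>R w \<omega>" for i \<omega>
  proof (cases "\<omega> \<in> A i")
    case True
    then show ?thesis
      using val[OF True, symmetric] by (cases "w \<omega> = 0") (auto simp: f_def sgn_div_norm)
  qed (simp add: f_def)
  have ae: "AE \<omega> in M. \<exists>k. \<omega> \<in> A k"
    using N UA by (intro AE_I'[OF N]) auto
  have s1: "AE \<omega> in M. (\<lambda>i. f i \<omega> *\<^sub>R y i) sums w \<omega>"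
    using ae by eventually_elim
      (use A(2) in \<open>auto simp: level intro: sums_indicator_disjoint_family\<close>)
  have s2: "AE \<omega> in M. (\<lambda>i. norm (f i \<omega> *\<^sub>R y i)) sums norm (w \<omega>)"
    using ae
  proof eventually_elim
    case (elim \<omega>)
    then obtain k where "\<omega> \<in> A k" by blast
    from sums_indicator_disjoint_family[OF A(2) this, of "\<lambda>_. norm (w \<omega>)"]
    show ?case by (simp only: level norm_scaleR) simp
  qed
  have "(\<lambda>i. \<integral>\<omega>. norm (f i \<omega> *\<^sub>R y i) \<partial>M) sums (\<integral>\<omega>. norm (w \<omega>) \<partial>M)"
    using f w s2 by (intro integral_sums_nonneg) auto
  then have "(\<lambda>i. L1_norm M (f i) * norm (y i)) sums L1_norm M w"
    by (simp add: L1_norm_def)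
  with f disj s1 s2 show ?thesis by (rule that)
qed

section \<open>Convergence and cost of tensor series\<close>

lemma
  fixes f :: "nat \<Rightarrow> 'a \<Rightarrow> real" and y :: "nat \<Rightarrow> 'b::real_normed_vector"
  assumes f: "\<And>i. integrable M (f i)"
  shows strongly_measurable_partial_sum: "strongly_measurable M (\<lambda>\<omega>. \<Sum>i<n. f i \<omega> *\<^sub>R y i)"
    and integrable_norm_partial_sum: "integrable M (\<lambda>\<omega>. norm (\<Sum>i<n. f i \<omega> *\<^sub>R y i))"
    and L1_norm_partial_sum_le: "L1_norm M (\<lambda>\<omega>. \<Sum>i<n. f i \<omega> *\<^sub>R y i) \<le> (\<Sum>i<n. L1_norm M (f i) * norm (y i))"
proof -
  show sm: "strongly_measurable M (\<lambda>\<omega>. \<Sum>i<n. f i \<omega> *\<^sub>R y i)"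
    using f by (intro strongly_measurable_sum strongly_measurable_scaleR strongly_measurable_borel
        strongly_measurable_simple[OF simple_function_const]) auto
  have bound: "norm (\<Sum>i<n. f i \<omega> *\<^sub>R y i) \<le> (\<Sum>i<n. norm (f i \<omega>) * norm (y i))" for \<omega>
    by (rule order_trans[OF norm_sum]) simp
  have int: "integrable M (\<lambda>\<omega>. \<Sum>i<n. norm (f i \<omega>) * norm (y i))"
    using f by auto
  show int': "integrable M (\<lambda>\<omega>. norm (\<Sum>i<n. f i \<omega> *\<^sub>R y i))"
    by (rule Bochner_Integration.integrable_bound[OF int borel_measurable_norm_strong[OF sm]])
      (use bound in \<open>auto intro: order_trans[OF _ abs_ge_self]\<close>)
  have "L1_norm M (\<lambda>\<omega>. \<Sum>i<n. f i \<omega> *\<^sub>R y i) \<le> (\<integral>\<omega>. (\<Sum>i<n. norm (f i \<omega>) * norm (y i)) \<partial>M)"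
    unfolding L1_norm_def by (rule integral_mono[OF int' int bound])
  also have "\<dots> = (\<Sum>i<n. L1_norm M (f i) * norm (y i))"
    using f by (simp add: L1_norm_def)
  finally show "L1_norm M (\<lambda>\<omega>. \<Sum>i<n. f i \<omega> *\<^sub>R y i) \<le> (\<Sum>i<n. L1_norm M (f i) * norm (y i))" .
qed

lemma integrable_norm_remainder:
  fixes u :: "'a \<Rightarrow> 'b::real_normed_vector" and f :: "nat \<Rightarrow> 'a \<Rightarrow> real"
  assumes u: "bochner_integrable M u" and f: "\<And>i. integrable M (f i)"
  shows "integrable M (\<lambda>\<omega>. norm (u \<omega> - (\<Sum>i<n. f i \<omega> *\<^sub>R y i)))"
  by (rule integrable_norm_diff[OF bochner_integrable_strongly_measurable[OF u]
        bochner_integrable_norm[OF u] strongly_measurable_partial_sum[where f = f, OF f]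
        integrable_norm_partial_sum[where f = f, OF f]])

lemma tensor_series_iff:
  fixes u :: "'a \<Rightarrow> 'b::real_normed_vector"
  assumes u: "bochner_integrable M u"
  shows "tensor_series M f y u \<longleftrightarrow> (\<forall>i. integrable M (f i)) \<and>
    (\<lambda>n. L1_norm M (\<lambda>\<omega>. u \<omega> - (\<Sum>i<n. f i \<omega> *\<^sub>R y i))) \<longlonglongrightarrow> 0"
proof (cases "\<forall>i. integrable M (f i)")
  case True
  then have "(\<integral>\<^sup>+\<omega>. ennreal (norm (u \<omega> - (\<Sum>i<n. f i \<omega> *\<^sub>R y i))) \<partial>M) =
      ennreal (L1_norm M (\<lambda>\<omega>. u \<omega> - (\<Sum>i<n. f i \<omega> *\<^sub>R y i)))" for n
    unfolding L1_norm_def by (intro nn_integral_eq_integral integrable_norm_remainder u) auto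
  then show ?thesis
    unfolding tensor_series_def
    using True tendsto_ennreal_iff[of "\<lambda>n. L1_norm M (\<lambda>\<omega>. u \<omega> - (\<Sum>i<n. f i \<omega> *\<^sub>R y i))" sequentially 0]
    by (simp add: L1_norm_nonneg)
qed (auto simp: tensor_series_def)

text \<open>L1 convergence gives almost everywhere convergence only along a subsequence of partial
  sums, but that subsequence must share the limit of a series already known to converge
  pointwise.\<close>

lemma tensor_series_AE_limit:
  fixes u :: "'a \<Rightarrow> 'b::real_normed_vector"
  assumes u: "bochner_integrable M u" and t: "tensor_series M f y u"
    and v: "AE \<omega> in M. (\<lambda>i. f i \<omega> *\<^sub>R y i) sums v \<omega>"
  shows "AE \<omega> in M. u \<omega> = v \<omega>"
proof -
  have f: "\<And>i. integrable M (f i)"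
    and lim: "(\<lambda>n. L1_norm M (\<lambda>\<omega>. u \<omega> - (\<Sum>i<n. f i \<omega> *\<^sub>R y i))) \<longlonglongrightarrow> 0"
    using t by (auto simp: tensor_series_iff[OF u])
  have "\<exists>r. strict_mono r \<and> (AE \<omega> in M. (\<lambda>n. norm (u \<omega> - (\<Sum>i<r n. f i \<omega> *\<^sub>R y i))) \<longlonglongrightarrow> 0)"
    by (rule tendsto_L1_AE_subseq[where u = "\<lambda>n \<omega>. norm (u \<omega> - (\<Sum>i<n. f i \<omega> *\<^sub>R y i))",
          OF integrable_norm_remainder[where f = f, OF u f]])
      (use lim in \<open>simp add: L1_norm_def\<close>)
  then obtain r :: "nat \<Rightarrow> nat" where r: "strict_mono r"
    and ae: "AE \<omega> in M. (\<lambda>n. norm (u \<omega> - (\<Sum>i<r n. f i \<omega> *\<^sub>R y i))) \<longlonglongrightarrow> 0"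
    by blast
  from ae v show ?thesis
  proof eventually_elim
    case (elim \<omega>)
    have "(\<lambda>n. u \<omega> - (\<Sum>i<r n. f i \<omega> *\<^sub>R y i)) \<longlonglongrightarrow> u \<omega> - v \<omega>"
      using elim(2) LIMSEQ_subseq_LIMSEQ[OF _ r]
      by (intro tendsto_diff tendsto_const) (auto simp: sums_def o_def)
    moreover have "(\<lambda>n. u \<omega> - (\<Sum>i<r n. f i \<omega> *\<^sub>R y i)) \<longlonglongrightarrow> 0"
      using elim(1) by (simp only: tendsto_norm_zero_iff)
    ultimately show ?case using LIMSEQ_unique by fastforce
  qed
qed

text \<open>The function \<open>\<Sum>i. norm (f i \<omega> *\<^sub>R y i)\<close> dominates all
  partial sums, and its integral is exactly the cost of the representation.\<close>

lemma
  fixes f :: "nat \<Rightarrow> 'a \<Rightarrow> real" and y :: "nat \<Rightarrow> 'b::real_normed_vector"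
  assumes f: "\<And>i. integrable M (f i)" and s: "summable (\<lambda>i. L1_norm M (f i) * norm (y i))"
  shows AE_summable_norm_terms: "AE \<omega> in M. summable (\<lambda>i. norm (f i \<omega> *\<^sub>R y i))"
    and integrable_suminf_norm_terms: "integrable M (\<lambda>\<omega>. \<Sum>i. norm (f i \<omega> *\<^sub>R y i))"
    and integral_suminf_norm_terms:
      "(\<integral>\<omega>. (\<Sum>i. norm (f i \<omega> *\<^sub>R y i)) \<partial>M) = (\<Sum>i. L1_norm M (f i) * norm (y i))"
proof -
  have int: "integrable M (\<lambda>\<omega>. norm (f i \<omega> *\<^sub>R y i))" for i
    using f by simp
  have L1: "(\<integral>\<omega>. norm (f i \<omega> *\<^sub>R y i) \<partial>M) = L1_norm M (f i) * norm (y i)" for i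
    by (simp add: L1_norm_def)
  have s': "summable (\<lambda>i. \<integral>\<omega>. norm (f i \<omega> *\<^sub>R y i) \<partial>M)" unfolding L1 by (rule s)
  show ae: "AE \<omega> in M. summable (\<lambda>i. norm (f i \<omega> *\<^sub>R y i))"
    by (rule AE_summable_nonneg[OF int norm_ge_zero s'])
  show "integrable M (\<lambda>\<omega>. \<Sum>i. norm (f i \<omega> *\<^sub>R y i))"
    by (rule integrable_suminf[OF int]) (use ae s' in simp_all)
  have "(\<integral>\<omega>. (\<Sum>i. norm (f i \<omega> *\<^sub>R y i)) \<partial>M) = (\<Sum>i. \<integral>\<omega>. norm (f i \<omega> *\<^sub>R y i) \<partial>M)"
    by (rule integral_suminf[OF int]) (use ae s' in simp_all)
  then show "(\<integral>\<omega>. (\<Sum>i. norm (f i \<omega> *\<^sub>R y i)) \<partial>M) = (\<Sum>i. L1_norm M (f i) * norm (y i))"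
    by (simp only: L1)
qed

text \<open>Finite cost upgrades pointwise convergence to L1 convergence: the remainders are
  dominated by \<open>norm (u \<omega>)\<close> plus the sum of the norms of the terms.\<close>

lemma tensor_seriesI:
  fixes u :: "'a \<Rightarrow> 'b::real_normed_vector"
  assumes u: "bochner_integrable M u" and f: "\<And>i. integrable M (f i)"
    and s: "summable (\<lambda>i. L1_norm M (f i) * norm (y i))"
    and ae: "AE \<omega> in M. (\<lambda>i. f i \<omega> *\<^sub>R y i) sums u \<omega>"
  shows "tensor_series M f y u"
proof -
  let ?H = "\<lambda>\<omega>. \<Sum>i. norm (f i \<omega> *\<^sub>R y i)"
  have "(\<lambda>n. \<integral>\<omega>. norm (u \<omega> - (\<Sum>i<n. f i \<omega> *\<^sub>R y i)) \<partial>M) \<longlonglongrightarrow> (\<integral>\<omega>. 0 \<partial>M)"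
  proof (rule integral_dominated_convergence[where w = "\<lambda>\<omega>. norm (u \<omega>) + ?H \<omega>"])
    show "integrable M (\<lambda>\<omega>. norm (u \<omega>) + ?H \<omega>)"
      using bochner_integrable_norm[OF u] integrable_suminf_norm_terms[OF f s] by simp
    show "AE \<omega> in M. (\<lambda>n. norm (u \<omega> - (\<Sum>i<n. f i \<omega> *\<^sub>R y i))) \<longlonglongrightarrow> 0"
      using ae
    proof eventually_elim
      case (elim \<omega>)
      then have "(\<lambda>n. u \<omega> - (\<Sum>i<n. f i \<omega> *\<^sub>R y i)) \<longlonglongrightarrow> u \<omega> - u \<omega>"
        unfolding sums_def by (intro tendsto_intros)
      then show ?case using tendsto_norm_zero by fastforce
    qed
    show "AE \<omega> in M. norm (norm (u \<omega> - (\<Sum>i<n. f i \<omega> *\<^sub>R y i))) \<le> norm (u \<omega>) + ?H \<omega>" for n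
      using AE_summable_norm_terms[OF f s]
    proof eventually_elim
      case (elim \<omega>)
      have "norm (\<Sum>i<n. f i \<omega> *\<^sub>R y i) \<le> (\<Sum>i<n. norm (f i \<omega> *\<^sub>R y i))"
        by (rule norm_sum)
      also have "\<dots> \<le> ?H \<omega>" by (rule sum_le_suminf[OF elim]) auto
      finally show ?case using norm_triangle_ineq4[of "u \<omega>" "\<Sum>i<n. f i \<omega> *\<^sub>R y i"] by simp
    qed
    show "(\<lambda>\<omega>. norm (u \<omega> - (\<Sum>i<n. f i \<omega> *\<^sub>R y i))) \<in> borel_measurable M" for n
      using integrable_norm_remainder[where f = f, OF u f] by (rule borel_measurable_integrable)
  qed simp
  then show ?thesis using f by (simp add: tensor_series_iff[OF u] L1_norm_def)
qed

text \<open>The triangle inequality bounds the norm by an L1 remainder plus the cost of the first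
  \<open>n\<close> terms, and the remainder tends to 0.\<close>

lemma L1_norm_le_tensor_series:
  fixes u :: "'a \<Rightarrow> 'b::real_normed_vector"
  assumes u: "bochner_integrable M u" and t: "tensor_series M f y u"
    and s: "(\<lambda>i. L1_norm M (f i) * norm (y i)) sums r"
  shows "L1_norm M u \<le> r"
proof -
  have f: "\<And>i. integrable M (f i)"
    and lim: "(\<lambda>n. L1_norm M (\<lambda>\<omega>. u \<omega> - (\<Sum>i<n. f i \<omega> *\<^sub>R y i))) \<longlonglongrightarrow> 0"
    using t by (auto simp: tensor_series_iff[OF u])
  have "L1_norm M u \<le> L1_norm M (\<lambda>\<omega>. u \<omega> - (\<Sum>i<n. f i \<omega> *\<^sub>R y i)) + (\<Sum>i<n. L1_norm M (f i) * norm (y i))" for n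
  proof -
    let ?S = "\<lambda>\<omega>. \<Sum>i<n. f i \<omega> *\<^sub>R y i"
    have "L1_norm M u \<le> (\<integral>\<omega>. norm (u \<omega> - ?S \<omega>) + norm (?S \<omega>) \<partial>M)"
      unfolding L1_norm_def
      by (intro integral_mono bochner_integrable_norm[OF u] Bochner_Integration.integrable_add
          integrable_norm_remainder[where f = f, OF u f] integrable_norm_partial_sum[where f = f, OF f])
        (metis norm_triangle_sub add.commute)
    also have "\<dots> = L1_norm M (\<lambda>\<omega>. u \<omega> - ?S \<omega>) + L1_norm M ?S"
      unfolding L1_norm_def
      by (intro Bochner_Integration.integral_add
          integrable_norm_remainder[where f = f, OF u f] integrable_norm_partial_sum[where f = f, OF f])
    finally show ?thesis using L1_norm_partial_sum_le[where f = f, OF f, where y = y and n = n] by linarith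
  qed
  then have le: "\<exists>N. \<forall>n\<ge>N. L1_norm M u \<le>
      L1_norm M (\<lambda>\<omega>. u \<omega> - (\<Sum>i<n. f i \<omega> *\<^sub>R y i)) + (\<Sum>i<n. L1_norm M (f i) * norm (y i))"
    by blast
  have "(\<lambda>n. L1_norm M (\<lambda>\<omega>. u \<omega> - (\<Sum>i<n. f i \<omega> *\<^sub>R y i)) + (\<Sum>i<n. L1_norm M (f i) * norm (y i))) \<longlonglongrightarrow> 0 + r"
    using s by (intro tendsto_add lim) (simp add: sums_def)
  from LIMSEQ_le_const[OF this le] show ?thesis by simp
qed

section \<open>The projective norm\<close>

text \<open>The totals \<open>c\<close> of the row norms are summable, so the double family is
  absolutely summable over pairs and may be listed in any order, here along the pairing bijection.
  It serves twice below: for the costs and, pointwise, for the vectors.\<close>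

lemma sums_prod_decode:
  fixes a :: "nat \<Rightarrow> nat \<Rightarrow> 'b::banach"
  assumes rows: "\<And>k. a k sums b k" and norms: "\<And>k. (\<lambda>j. norm (a k j)) sums c k"
    and c: "summable c" and b: "b sums B"
  shows "(\<lambda>n. a (fst (prod_decode n)) (snd (prod_decode n))) sums B"
proof -
  let ?f = "\<lambda>p. a (fst p) (snd p)"
  have c_nonneg: "c k \<ge> 0" for k
    using sums_le[OF _ sums_zero norms[of k]] by simp
  have "norm (b k) \<le> c k" for k
    using summable_norm[OF sums_summable[OF norms[of k]]] rows[of k] norms[of k] by (simp add: sums_iff)
  then have "summable (\<lambda>k. norm (b k))"
    by (intro summable_comparison_test[OF _ c]) auto
  then have b': "(b has_sum B) UNIV" by (rule norm_summable_imp_has_sum[OF _ b])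
  have row: "((\<lambda>j. ?f (k, j)) has_sum b k) UNIV" for k
    using norm_summable_imp_has_sum[OF sums_summable[OF norms] rows] by simp
  have "(\<lambda>p. norm (?f p)) summable_on (SIGMA k:UNIV. UNIV)"
  proof (rule summable_on_SigmaI)
    show "((\<lambda>j. norm (?f (k, j))) has_sum c k) UNIV" for k
      using sums_nonneg_imp_has_sum[OF norms] by simp
    show "c summable_on UNIV"
      using c c_nonneg by (simp add: summable_on_UNIV_nonneg_real_iff)
  qed simp
  then have "?f summable_on (SIGMA k:UNIV. UNIV)" by (rule abs_summable_summable)
  then have "(?f has_sum B) (SIGMA k:UNIV. UNIV)"
    by (intro has_sum_SigmaI[OF _ b']) (use row in simp_all)
  then have "((\<lambda>n. ?f (prod_decode n)) has_sum B) UNIV"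
    using has_sum_reindex_bij_betw[OF bij_prod_decode, of ?f B] by simp
  then show ?thesis by (rule has_sum_imp_sums)
qed

lemma simple_function_essentially_countably_valued:
  assumes "simple_function M f"
  shows "essentially_countably_valued M f"
  unfolding essentially_countably_valued_def
  using borel_measurable_simple_function[OF assms] simple_functionD(1)[OF assms]
  by (auto intro!: bexI[of _ "{}"] countable_finite)

lemma L1_norm_diff_le:
  fixes f g h :: "'a \<Rightarrow> 'b::real_normed_vector"
  assumes "integrable M (\<lambda>\<omega>. norm (f \<omega> - g \<omega>))" "integrable M (\<lambda>\<omega>. norm (f \<omega> - h \<omega>))"
    and "integrable M (\<lambda>\<omega>. norm (g \<omega> - h \<omega>))"
  shows "L1_norm M (\<lambda>\<omega>. g \<omega> - h \<omega>) \<le> L1_norm M (\<lambda>\<omega>. f \<omega> - g \<omega>) + L1_norm M (\<lambda>\<omega>. f \<omega> - h \<omega>)"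
proof -
  have "L1_norm M (\<lambda>\<omega>. g \<omega> - h \<omega>) \<le> (\<integral>\<omega>. norm (f \<omega> - g \<omega>) + norm (f \<omega> - h \<omega>) \<partial>M)"
    unfolding L1_norm_def
    by (intro integral_mono assms Bochner_Integration.integrable_add)
      (metis norm_diff_triangle_le norm_minus_commute order_refl)
  also have "\<dots> = L1_norm M (\<lambda>\<omega>. f \<omega> - g \<omega>) + L1_norm M (\<lambda>\<omega>. f \<omega> - h \<omega>)"
    unfolding L1_norm_def by (intro Bochner_Integration.integral_add assms)
  finally show ?thesis .
qed

text \<open>Write \<open>u\<close> as the telescoping sum of differences \<open>d k\<close> of
  simple approximants. Each \<open>d k\<close> takes finitely many values, so
  \<open>radial_decomposition\<close> represents it at cost exactly \<open>L1_norm M (d k)\<close>;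
  merging these series costs the sum of those norms.\<close>

lemma tensor_series_near_L1_norm:
  fixes u :: "'a \<Rightarrow> 'b::banach"
  assumes u: "bochner_integrable M u" and e: "e > 0"
  obtains f y r where "tensor_series M f y u" "(\<lambda>i. L1_norm M (f i) * norm (y i)) sums r"
    "r \<le> L1_norm M u + e"
proof -
  \<comment> \<open>The differences after the first cost at most \<open>2 * \<epsilon> k\<close>
    each, \<open>e / 2\<close> in total, and the first exceeds \<open>L1_norm M u\<close> by at most
    \<open>\<epsilon> 0 = e / 8\<close>, which stays within \<open>e\<close>.\<close>
  define \<epsilon> where "\<epsilon> k = e / 8 * (1 / 2) ^ k" for k :: nat
  have \<epsilon>: "\<epsilon> k > 0" for k using e by (simp add: \<epsilon>_def)
  have \<epsilon>_sums: "(\<lambda>k. 2 * \<epsilon> k) sums (e / 2)"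
    using sums_mult[OF geometric_sums[of "1 / 2 :: real"], of "e / 4"] by (simp add: \<epsilon>_def)
  have "\<forall>k. \<exists>s. simple_function M s \<and> integrable M (\<lambda>\<omega>. norm (s \<omega>)) \<and>
      integrable M (\<lambda>\<omega>. norm (u \<omega> - s \<omega>)) \<and> L1_norm M (\<lambda>\<omega>. u \<omega> - s \<omega>) < \<epsilon> k"
    by (rule allI, rule bochner_integrable_simple_approx[OF u \<epsilon>]) blast
  then obtain s where s: "\<And>k. simple_function M (s k)" "\<And>k. integrable M (\<lambda>\<omega>. norm (s k \<omega>))"
    "\<And>k. integrable M (\<lambda>\<omega>. norm (u \<omega> - s k \<omega>))" "\<And>k. L1_norm M (\<lambda>\<omega>. u \<omega> - s k \<omega>) < \<epsilon> k"
    by metis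
  define d where "d k \<omega> = s k \<omega> - (if k = 0 then 0 else s (k - 1) \<omega>)" for k \<omega>
  have d0: "d 0 = s 0" and dSuc: "d (Suc k) = (\<lambda>\<omega>. s (Suc k) \<omega> - s k \<omega>)" for k
    by (simp_all add: d_def fun_eq_iff)
  have d_simple: "simple_function M (d k)" for k
  proof (cases k)
    case (Suc n)
    show ?thesis
      unfolding Suc dSuc by (intro simple_function_compose2[where h = "(-)"] s)
  qed (simp add: d0 s(1))
  have d_int: "integrable M (\<lambda>\<omega>. norm (d k \<omega>))" for k
  proof (cases k)
    case (Suc n)
    show ?thesis
      unfolding Suc dSuc by (intro integrable_norm_diff strongly_measurable_simple s)
  qed (simp add: d0 s(2))
  have "L1_norm M (s 0) \<le> (\<integral>\<omega>. norm (u \<omega>) + norm (u \<omega> - s 0 \<omega>) \<partial>M)"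
    unfolding L1_norm_def
    by (intro integral_mono s Bochner_Integration.integrable_add bochner_integrable_norm[OF u])
      (use norm_triangle_ineq4[of "u x" "u x - s 0 x" for x] in simp)
  also have "\<dots> = L1_norm M u + L1_norm M (\<lambda>\<omega>. u \<omega> - s 0 \<omega>)"
    unfolding L1_norm_def
    by (intro Bochner_Integration.integral_add s bochner_integrable_norm[OF u])
  finally have L0: "L1_norm M (d 0) \<le> L1_norm M u + e / 8"
    using s(4)[of 0] by (simp add: d0 \<epsilon>_def)
  have LSuc: "L1_norm M (d (Suc k)) \<le> 2 * \<epsilon> k" for k
  proof -
    have "L1_norm M (d (Suc k)) \<le> L1_norm M (\<lambda>\<omega>. u \<omega> - s (Suc k) \<omega>) + L1_norm M (\<lambda>\<omega>. u \<omega> - s k \<omega>)"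
      unfolding dSuc by (intro L1_norm_diff_le s d_int[of "Suc k", unfolded dSuc])
    moreover have "\<epsilon> (Suc k) \<le> \<epsilon> k" using e by (simp add: \<epsilon>_def)
    ultimately show ?thesis using s(4)[of k] s(4)[of "Suc k"] by simp
  qed
  have sumSuc: "summable (\<lambda>k. L1_norm M (d (Suc k)))"
    by (rule summable_comparison_test[OF _ sums_summable[OF \<epsilon>_sums]])
      (use LSuc in \<open>auto simp: L1_norm_nonneg\<close>)
  have sumL: "summable (\<lambda>k. L1_norm M (d k))"
    by (rule iffD1[OF summable_Suc_iff sumSuc])
  have "(\<Sum>k. L1_norm M (d k)) = L1_norm M (d 0) + (\<Sum>k. L1_norm M (d (Suc k)))"
    using suminf_split_head[OF sumL] by simp
  also have "(\<Sum>k. L1_norm M (d (Suc k))) \<le> e / 2"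
    using suminf_le[OF LSuc sumSuc sums_summable[OF \<epsilon>_sums]] sums_unique[OF \<epsilon>_sums] by simp
  finally have bound: "(\<Sum>k. L1_norm M (d k)) \<le> L1_norm M u + e"
    using L0 e by simp

  \<comment> \<open>Bundling the four properties lets one choice step select the representations of
    all \<open>d k\<close> simultaneously.\<close>
  define Q where "Q k f y \<longleftrightarrow> (\<forall>i. integrable M (f i)) \<and>
      (AE \<omega> in M. (\<lambda>i. f i \<omega> *\<^sub>R y i) sums d k \<omega>) \<and>
      (AE \<omega> in M. (\<lambda>i. norm (f i \<omega> *\<^sub>R y i)) sums norm (d k \<omega>)) \<and>
      (\<lambda>i. L1_norm M (f i) * norm (y i)) sums L1_norm M (d k)"
    for k and f :: "nat \<Rightarrow> 'a \<Rightarrow> real" and y :: "nat \<Rightarrow> 'b"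
  have "\<exists>f y. Q k f y" for k
  proof -
    have "essentially_countably_valued M (\<lambda>\<omega>. sgn (d k \<omega>))"
      by (rule simple_function_essentially_countably_valued[OF simple_function_compose1[OF d_simple]])
    then obtain f y where "\<And>i::nat. integrable M (f i)"
      "AE \<omega> in M. (\<lambda>i. f i \<omega> *\<^sub>R y i) sums d k \<omega>"
      "AE \<omega> in M. (\<lambda>i. norm (f i \<omega> *\<^sub>R y i)) sums norm (d k \<omega>)"
      "(\<lambda>i. L1_norm M (f i) * norm (y i)) sums L1_norm M (d k)"
      by (rule radial_decomposition[OF d_int]) (rule that)
    then have "Q k f y" unfolding Q_def by (intro conjI allI)
    then show ?thesis by blast
  qed
  then obtain F Y where Q: "\<And>k. Q k (F k) (Y k)" by metis
  have F: "integrable M (F k i)" for k i using Q[of k] unfolding Q_def by (elim conjE allE)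
  have FY: "AE \<omega> in M. (\<lambda>i. F k i \<omega> *\<^sub>R Y k i) sums d k \<omega>"
      "AE \<omega> in M. (\<lambda>i. norm (F k i \<omega> *\<^sub>R Y k i)) sums norm (d k \<omega>)"
    and cost: "(\<lambda>i. L1_norm M (F k i) * norm (Y k i)) sums L1_norm M (d k)" for k
    using Q[of k] unfolding Q_def by - (elim conjE, assumption)+
  define f where "f n = F (fst (prod_decode n)) (snd (prod_decode n))" for n
  define y where "y n = Y (fst (prod_decode n)) (snd (prod_decode n))" for n
  have f: "integrable M (f n)" for n unfolding f_def by (rule F)
  have total: "(\<lambda>n. L1_norm M (f n) * norm (y n)) sums (\<Sum>k. L1_norm M (d k))"
    unfolding f_def y_def
    by (rule sums_prod_decode[where c = "\<lambda>k. L1_norm M (d k)"])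
      (use cost sumL summable_sums[OF sumL] in \<open>simp_all add: L1_norm_nonneg abs_mult\<close>)
  \<comment> \<open>The errors are summable and not merely null, so the whole sequence
    \<open>s k\<close> converges almost everywhere, without passing to a subsequence.\<close>
  have conv: "AE \<omega> in M. (\<lambda>k. d k \<omega>) sums u \<omega>"
  proof -
    have "norm (\<integral>\<omega>. norm (u \<omega> - s k \<omega>) \<partial>M) \<le> 2 * \<epsilon> k" for k
      using s(4)[of k] \<epsilon>[of k] by (simp add: L1_norm_def)
    then have "summable (\<lambda>k. \<integral>\<omega>. norm (u \<omega> - s k \<omega>) \<partial>M)"
      by (intro summable_comparison_test[OF _ sums_summable[OF \<epsilon>_sums]]) blast
    from AE_summable_nonneg[OF s(3) norm_ge_zero this] show ?thesis
    proof eventually_elim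
      case (elim \<omega>)
      then have "(\<lambda>k. u \<omega> - s k \<omega>) \<longlonglongrightarrow> 0"
        using summable_LIMSEQ_zero tendsto_norm_zero_iff by blast
      then have "(\<lambda>k. u \<omega> - (u \<omega> - s k \<omega>)) \<longlonglongrightarrow> u \<omega> - 0" by (intro tendsto_intros)
      \<comment> \<open>Here \<open>n + 1\<close> differences collapse to \<open>s n\<close>, which
        accounts for the index shift removed by \<open>LIMSEQ_imp_Suc\<close>.\<close>
      moreover have "(\<Sum>k<Suc n. d k \<omega>) = s n \<omega>" for n
        by (induction n) (simp_all add: d_def)
      ultimately have "(\<lambda>n. \<Sum>k<Suc n. d k \<omega>) \<longlonglongrightarrow> u \<omega>" by simp
      then show ?case unfolding sums_def by (rule LIMSEQ_imp_Suc)
    qed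
  qed
  have "AE \<omega> in M. summable (\<lambda>k. norm (d k \<omega>))"
    by (rule AE_summable_nonneg[OF d_int norm_ge_zero]) (use sumL in \<open>simp add: L1_norm_def\<close>)
  moreover have "AE \<omega> in M. \<forall>k. (\<lambda>i. F k i \<omega> *\<^sub>R Y k i) sums d k \<omega>"
    "AE \<omega> in M. \<forall>k. (\<lambda>i. norm (F k i \<omega> *\<^sub>R Y k i)) sums norm (d k \<omega>)"
    using FY by (simp_all add: AE_all_countable)
  ultimately have "AE \<omega> in M. (\<lambda>n. f n \<omega> *\<^sub>R y n) sums u \<omega>"
    using conv
  proof eventually_elim
    case (elim \<omega>)
    show ?case
      unfolding f_def y_def
      by (rule sums_prod_decode[where a = "\<lambda>k i. F k i \<omega> *\<^sub>R Y k i"]) (use elim in auto)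
  qed
  then have "tensor_series M f y u"
    by (rule tensor_seriesI[where f = f, OF u f sums_summable[OF total]])
  from this total bound show ?thesis by (rule that)
qed

lemma projective_norm_eq_L1_norm:
  fixes u :: "'a \<Rightarrow> 'b::banach"
  assumes u: "bochner_integrable M u"
  shows "projective_norm M u = L1_norm M u"
proof (rule antisym)
  let ?R = "{r. \<exists>f y. tensor_series M f y u \<and> (\<lambda>i. L1_norm M (f i) * norm (y i)) sums r}"
  have lower: "L1_norm M u \<le> r" if "r \<in> ?R" for r
    using that L1_norm_le_tensor_series[OF u] by blast
  show "L1_norm M u \<le> projective_norm M u"
    unfolding projective_norm_def
  proof (rule cInf_greatest[OF _ lower])
    show "?R \<noteq> {}" by (rule tensor_series_near_L1_norm[OF u zero_less_one]) blast
  qed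
  show "projective_norm M u \<le> L1_norm M u"
  proof (rule field_le_epsilon)
    fix e :: real assume "e > 0"
    then obtain f y r where r: "tensor_series M f y u" "(\<lambda>i. L1_norm M (f i) * norm (y i)) sums r"
      "r \<le> L1_norm M u + e"
      by (rule tensor_series_near_L1_norm[OF u]) (rule that)
    have "projective_norm M u \<le> r"
      unfolding projective_norm_def
      by (rule cInf_lower) (use r lower in \<open>auto simp: bdd_below_def\<close>)
    with r(3) show "projective_norm M u \<le> L1_norm M u + e" by simp
  qed
qed

section \<open>The total variation\<close>

lemma sum_integral_partition:
  fixes h :: "'a \<Rightarrow> real"
  assumes P: "finite P" "P \<subseteq> sets M" "partition_on (space M) P" and h: "integrable M h"
  shows "(\<Sum>A\<in>P. \<integral>\<omega>. indicator A \<omega> * h \<omega> \<partial>M) = (\<integral>\<omega>. h \<omega> \<partial>M)"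
proof -
  have int: "integrable M (\<lambda>\<omega>. indicator A \<omega> * h \<omega>)" if "A \<in> P" for A
    using integrable_mult_indicator[OF _ h, of A] that P(2) by auto
  have "(\<Sum>A\<in>P. indicator A \<omega> * h \<omega>) = h \<omega>" if \<omega>: "\<omega> \<in> space M" for \<omega>
  proof -
    obtain B where B: "B \<in> P" "\<omega> \<in> B" using P(3) \<omega> by (auto simp: partition_on_def)
    have "indicator A \<omega> * h \<omega> = (if A = B then h \<omega> else 0)" if "A \<in> P" for A
      using P(3) B that by (auto simp: partition_on_def disjoint_def split: split_indicator)
    then have "(\<Sum>A\<in>P. indicator A \<omega> * h \<omega>) = (\<Sum>A\<in>P. if A = B then h \<omega> else 0)"
      by (rule sum.cong[OF refl])
    then show ?thesis using P(1) B(1) by simp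
  qed
  then have "(\<integral>\<omega>. h \<omega> \<partial>M) = (\<integral>\<omega>. (\<Sum>A\<in>P. indicator A \<omega> * h \<omega>) \<partial>M)"
    by (intro Bochner_Integration.integral_cong) simp_all
  also have "\<dots> = (\<Sum>A\<in>P. \<integral>\<omega>. indicator A \<omega> * h \<omega> \<partial>M)"
    by (rule Bochner_Integration.integral_sum[OF int])
  finally show ?thesis by simp
qed

lemma sum_norm_indefinite_integral_le:
  fixes u :: "'a \<Rightarrow> 'b::banach"
  assumes u: "bochner_integrable M u"
    and P: "finite P" "P \<subseteq> sets M" "partition_on (space M) P"
  shows "(\<Sum>A\<in>P. norm (indefinite_integral M u A)) \<le> L1_norm M u"
proof -
  have "(\<Sum>A\<in>P. norm (indefinite_integral M u A)) \<le> (\<Sum>A\<in>P. \<integral>\<omega>. indicator A \<omega> * norm (u \<omega>) \<partial>M)"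
    using P(2) by (intro sum_mono norm_indefinite_integral_le[OF u]) auto
  also have "\<dots> = L1_norm M u"
    unfolding L1_norm_def by (rule sum_integral_partition[OF P bochner_integrable_norm[OF u]])
  finally show ?thesis .
qed

text \<open>Test against a functional norming the constant \<open>v\<close>. The error
  \<open>norm (u \<omega> - v)\<close> enters twice: once when \<open>u \<omega>\<close> is replaced
  by \<open>v\<close> under the functional, once when \<open>norm v\<close> is compared with
  \<open>norm (u \<omega>)\<close>.\<close>

lemma norm_indefinite_integral_ge_near_const:
  fixes u :: "'a \<Rightarrow> 'b::banach"
  assumes u: "bochner_integrable M u" and A: "A \<in> sets M"
    and s: "integrable M (\<lambda>\<omega>. norm (u \<omega> - s \<omega>))" and v: "\<And>\<omega>. \<omega> \<in> A \<Longrightarrow> s \<omega> = v"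
  shows "(\<integral>\<omega>. indicator A \<omega> * (norm (u \<omega>) - 2 * norm (u \<omega> - s \<omega>)) \<partial>M) \<le> norm (indefinite_integral M u A)"
proof -
  obtain \<phi> :: "'b \<Rightarrow>\<^sub>L real" where \<phi>: "norm \<phi> \<le> 1" "blinfun_apply \<phi> v = norm v"
    using ex_norming_functional by blast
  have "(\<integral>\<omega>. indicator A \<omega> * (norm (u \<omega>) - 2 * norm (u \<omega> - s \<omega>)) \<partial>M)
      \<le> (\<integral>\<omega>. indicator A \<omega> * blinfun_apply \<phi> (u \<omega>) \<partial>M)"
  proof (rule integral_mono)
    have "integrable M (\<lambda>\<omega>. norm (u \<omega>) - 2 * norm (u \<omega> - s \<omega>))"
      using bochner_integrable_norm[OF u] s by simp
    from integrable_mult_indicator[OF A this]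
    show "integrable M (\<lambda>\<omega>. indicator A \<omega> * (norm (u \<omega>) - 2 * norm (u \<omega> - s \<omega>)))" by simp
    show "integrable M (\<lambda>\<omega>. indicator A \<omega> * blinfun_apply \<phi> (u \<omega>))"
      by (rule indefinite_integral_functional(1)[OF u A \<phi>(1)])
    show "indicator A \<omega> * (norm (u \<omega>) - 2 * norm (u \<omega> - s \<omega>)) \<le> indicator A \<omega> * blinfun_apply \<phi> (u \<omega>)" for \<omega>
    proof (cases "\<omega> \<in> A")
      case True
      have "blinfun_apply \<phi> (u \<omega>) = norm v + blinfun_apply \<phi> (u \<omega> - v)"
        using \<phi>(2) by (simp add: blinfun.diff_right)
      moreover have "\<bar>blinfun_apply \<phi> (u \<omega> - v)\<bar> \<le> norm (u \<omega> - v)"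
        by (rule abs_blinfun_le_norm[OF \<phi>(1)])
      moreover have "norm (u \<omega>) \<le> norm v + norm (u \<omega> - v)" by (rule norm_triangle_sub)
      ultimately show ?thesis using True v by simp
    qed simp
  qed
  also have "\<dots> = blinfun_apply \<phi> (indefinite_integral M u A)"
    by (rule indefinite_integral_functional(2)[OF u A \<phi>(1)])
  also have "\<dots> \<le> norm (indefinite_integral M u A)"
    using abs_blinfun_le_norm[OF \<phi>(1), of "indefinite_integral M u A"] by simp
  finally show ?thesis .
qed

lemma partition_near_L1_norm:
  fixes u :: "'a \<Rightarrow> 'b::banach"
  assumes u: "bochner_integrable M u" and e: "e > 0"
  obtains P where "finite P" "P \<subseteq> sets M" "partition_on (space M) P"
    "L1_norm M u - e \<le> (\<Sum>A\<in>P. norm (indefinite_integral M u A))"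
proof -
  \<comment> \<open>The margin \<open>e / 2\<close> compensates for the factor 2 in the preceding
    estimate.\<close>
  obtain s where s: "simple_function M s" "integrable M (\<lambda>\<omega>. norm (u \<omega> - s \<omega>))"
    "L1_norm M (\<lambda>\<omega>. u \<omega> - s \<omega>) < e / 2"
    using bochner_integrable_simple_approx[OF u, of "e / 2"] e by auto
  let ?h = "\<lambda>\<omega>. norm (u \<omega>) - 2 * norm (u \<omega> - s \<omega>)"
  \<comment> \<open>Only attained values are used, since the blocks of a partition must be
    nonempty.\<close>
  define P where "P = (\<lambda>v. s -` {v} \<inter> space M) ` (s ` space M)"
  have P: "finite P" "P \<subseteq> sets M" "partition_on (space M) P"
    using simple_functionD[OF s(1)] by (auto simp: P_def partition_on_def disjoint_def)
  have "(\<integral>\<omega>. indicator A \<omega> * ?h \<omega> \<partial>M) \<le> norm (indefinite_integral M u A)" if A: "A \<in> P" for A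
  proof -
    obtain v where "A = s -` {v} \<inter> space M" using A by (auto simp: P_def)
    then show ?thesis
      using P(2) A by (intro norm_indefinite_integral_ge_near_const[OF u _ s(2), of A v]) auto
  qed
  then have "(\<Sum>A\<in>P. \<integral>\<omega>. indicator A \<omega> * ?h \<omega> \<partial>M) \<le> (\<Sum>A\<in>P. norm (indefinite_integral M u A))"
    by (rule sum_mono)
  moreover have "(\<Sum>A\<in>P. \<integral>\<omega>. indicator A \<omega> * ?h \<omega> \<partial>M) = (\<integral>\<omega>. ?h \<omega> \<partial>M)"
    by (rule sum_integral_partition[OF P]) (use bochner_integrable_norm[OF u] s(2) in simp)
  moreover have "(\<integral>\<omega>. ?h \<omega> \<partial>M) = L1_norm M u - 2 * L1_norm M (\<lambda>\<omega>. u \<omega> - s \<omega>)"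
    unfolding L1_norm_def using bochner_integrable_norm[OF u] s(2) by simp
  ultimately show ?thesis using s(3) by (intro that[OF P]) simp
qed

lemma total_variation_eq_L1_norm:
  fixes u :: "'a \<Rightarrow> 'b::banach"
  assumes u: "bochner_integrable M u"
  shows "total_variation M u = L1_norm M u"
proof (rule antisym)
  let ?P = "{P. finite P \<and> P \<subseteq> sets M \<and> partition_on (space M) P}"
  let ?v = "\<lambda>P. \<Sum>A\<in>P. norm (indefinite_integral M u A)"
  have upper: "?v P \<le> L1_norm M u" if "P \<in> ?P" for P
    using that sum_norm_indefinite_integral_le[OF u] by blast
  show "total_variation M u \<le> L1_norm M u"
    unfolding total_variation_def
  proof (rule cSUP_least[OF _ upper])
    show "?P \<noteq> {}" by (rule partition_near_L1_norm[OF u zero_less_one]) blast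
  qed
  show "L1_norm M u \<le> total_variation M u"
  proof (rule field_le_epsilon)
    fix e :: real assume "e > 0"
    then obtain P where P: "P \<in> ?P" and le: "L1_norm M u - e \<le> ?v P"
      by (rule partition_near_L1_norm[OF u]) blast
    have "?v P \<le> total_variation M u"
      unfolding total_variation_def
      by (rule cSUP_upper[OF P]) (rule bdd_aboveI2[OF upper])
    with le show "L1_norm M u \<le> total_variation M u + e" by simp
  qed
qed

section \<open>The equivalences\<close>

lemma sgn_scaleR_cases:
  fixes y :: "'b::real_normed_vector"
  shows "sgn (c *\<^sub>R y) \<in> {0, sgn y, - sgn y}"
  by (cases c "0 :: real" rule: linorder_cases) (auto simp: sgn_scaleR)

lemma countable_signed_sgn: "countable (\<Union>i::nat. {0, sgn (y i), - sgn (y i :: 'b::real_normed_vector)})"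
  by (intro countable_UN) simp_all

lemma borel_measurable_sgn_bochner:
  fixes u :: "'a \<Rightarrow> 'b::real_normed_vector"
  shows "bochner_integrable M u \<Longrightarrow> (\<lambda>\<omega>. sgn (u \<omega>)) \<in> borel_measurable M"
  by (intro borel_measurable_strongly_measurable strongly_measurable_sgn
      bochner_integrable_strongly_measurable)

text \<open>At optimal cost \<open>norm (u \<omega>)\<close> and the larger sum of the norms of the
  terms have equal integrals, so they agree almost everywhere. Without slack in the triangle
  inequality, every nonzero term points in the direction of \<open>u \<omega>\<close>, and its
  scalar factor affects that direction by a sign only.\<close>

lemma attains_projective_norm_imp_sgn_countable:
  fixes u :: "'a \<Rightarrow> 'b::banach"
  assumes sc: "strictly_convex_space TYPE('b)" and u: "bochner_integrable M u"
    and att: "attains_projective_norm M u"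
  shows "essentially_countably_valued M (\<lambda>\<omega>. sgn (u \<omega>))"
proof -
  obtain f y where t: "tensor_series M f y u"
    and cost: "(\<lambda>i. L1_norm M (f i) * norm (y i)) sums L1_norm M u"
    using att unfolding attains_projective_norm_def projective_norm_eq_L1_norm[OF u] by blast
  have f: "integrable M (f i)" for i using t by (simp add: tensor_series_def)
  note s = sums_summable[OF cost]
  let ?H = "\<lambda>\<omega>. \<Sum>i. norm (f i \<omega> *\<^sub>R y i)"
  have H: "AE \<omega> in M. summable (\<lambda>i. norm (f i \<omega> *\<^sub>R y i))"
    by (rule AE_summable_norm_terms[where f = f, OF f s])
  \<comment> \<open>Absolute convergence yields some pointwise sum by completeness; it is then
    identified with \<open>u\<close> through the L1 limit.\<close>
  have "AE \<omega> in M. (\<lambda>i. f i \<omega> *\<^sub>R y i) sums (\<Sum>i. f i \<omega> *\<^sub>R y i)"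
    using H by eventually_elim (rule summable_sums[OF summable_norm_cancel])
  from tensor_series_AE_limit[OF u t this] this
  have conv: "AE \<omega> in M. (\<lambda>i. f i \<omega> *\<^sub>R y i) sums u \<omega>"
    by eventually_elim simp
  have le: "AE \<omega> in M. norm (u \<omega>) \<le> ?H \<omega>"
    using H conv
  proof eventually_elim
    case (elim \<omega>)
    then show ?case using summable_norm[OF elim(1)] sums_unique[OF elim(2)] by simp
  qed
  have "L1_norm M u = (\<integral>\<omega>. ?H \<omega> \<partial>M)"
    unfolding integral_suminf_norm_terms[where f = f, OF f s] by (rule sums_unique[OF cost])
  then have "(\<integral>\<omega>. norm (u \<omega>) \<partial>M) = (\<integral>\<omega>. ?H \<omega> \<partial>M)" by (simp only: L1_norm_def)
  then have eq: "AE \<omega> in M. norm (u \<omega>) = ?H \<omega>"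
    by (rule integral_ineq_eq_0_then_AE[OF le bochner_integrable_norm[OF u]
          integrable_suminf_norm_terms[where f = f, OF f s]])
  have "AE \<omega> in M. sgn (u \<omega>) \<in> (\<Union>i. {0, sgn (y i), - sgn (y i)})"
    using H conv eq
  proof eventually_elim
    case (elim \<omega>)
    show ?case
    proof (cases "u \<omega> = 0")
      case False
      have "\<exists>i. f i \<omega> *\<^sub>R y i \<noteq> 0"
      proof (rule ccontr)
        assume "\<not> ?thesis"
        then have zero: "(\<lambda>i. f i \<omega> *\<^sub>R y i) = (\<lambda>_. 0)" by (intro ext) blast
        from sums_unique[OF elim(2)] show False using False unfolding zero by simp
      qed
      then obtain i where i: "f i \<omega> *\<^sub>R y i \<noteq> 0" by blast
      have norms: "(\<lambda>i. norm (f i \<omega> *\<^sub>R y i)) sums norm (u \<omega>)"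
        unfolding elim(3) by (rule summable_sums[OF elim(1)])
      have "sgn (u \<omega>) \<in> {0, sgn (y i), - sgn (y i)}"
        using sgn_scaleR_cases[of "f i \<omega>" "y i"]
        unfolding strictly_convex_sums_sgn[OF sc elim(2) norms False i] .
      then show ?thesis by blast
    qed simp
  qed
  with borel_measurable_sgn_bochner[OF u] countable_signed_sgn show ?thesis
    by (rule essentially_countably_valuedI_AE)
qed

text \<open>Discarding countably many null intersections leaves at most one nonzero term at each
  point, so the series converges pointwise and \<open>u \<omega>\<close> is a multiple of a single
  \<open>y k\<close>.\<close>

lemma disjoint_tensor_series_imp_sgn_countable:
  fixes u :: "'a \<Rightarrow> 'b::banach"
  assumes u: "bochner_integrable M u" and t: "tensor_series M f y u"
    and disj: "\<And>i j. i \<noteq> j \<Longrightarrow> emeasure M (supp_on M (f i) \<inter> supp_on M (f j)) = 0"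
  shows "essentially_countably_valued M (\<lambda>\<omega>. sgn (u \<omega>))"
proof -
  have f: "integrable M (f i)" for i using t by (simp add: tensor_series_def)
  have [measurable]: "f i \<in> borel_measurable M" for i
    using f by (rule borel_measurable_integrable)
  have "AE \<omega> in M. i \<noteq> j \<longrightarrow> f i \<omega> = 0 \<or> f j \<omega> = 0" for i j
  proof (cases "i = j")
    case False
    have m: "supp_on M (f i) \<inter> supp_on M (f j) \<in> sets M"
      unfolding supp_on_def by measurable
    with disj[OF False] have "supp_on M (f i) \<inter> supp_on M (f j) \<in> null_sets M" by auto
    from AE_not_in[OF this] show ?thesis
      using AE_space by eventually_elim (auto simp: supp_on_def)
  qed simp
  then have ae: "AE \<omega> in M. \<forall>i j. i \<noteq> j \<longrightarrow> f i \<omega> = 0 \<or> f j \<omega> = 0"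
    by (simp add: AE_all_countable)
  have key: "\<exists>k. (\<lambda>i. f i \<omega> *\<^sub>R y i) sums (f k \<omega> *\<^sub>R y k)"
    if \<omega>: "\<forall>i j. i \<noteq> j \<longrightarrow> f i \<omega> = 0 \<or> f j \<omega> = 0" for \<omega>
  proof (cases "\<forall>i. f i \<omega> = 0")
    case False
    then obtain k where "f k \<omega> \<noteq> 0" by blast
    then have "(\<lambda>i. f i \<omega> *\<^sub>R y i) = (\<lambda>i. if i = k then f i \<omega> *\<^sub>R y i else 0)"
      using \<omega> by (auto simp: fun_eq_iff)
    with sums_single[of k "\<lambda>i. f i \<omega> *\<^sub>R y i"] show ?thesis by auto
  qed simp
  have "AE \<omega> in M. (\<lambda>i. f i \<omega> *\<^sub>R y i) sums (\<Sum>i. f i \<omega> *\<^sub>R y i)"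
    using ae by eventually_elim (use key in \<open>auto dest!: sums_summable intro!: summable_sums\<close>)
  from tensor_series_AE_limit[OF u t this] ae
  have "AE \<omega> in M. sgn (u \<omega>) \<in> (\<Union>i. {0, sgn (y i), - sgn (y i)})"
  proof eventually_elim
    case (elim \<omega>)
    obtain k where "(\<lambda>i. f i \<omega> *\<^sub>R y i) sums (f k \<omega> *\<^sub>R y k)" using key[OF elim(2)] by blast
    then have "u \<omega> = f k \<omega> *\<^sub>R y k" using elim(1) sums_unique by metis
    then have "sgn (u \<omega>) \<in> {0, sgn (y k), - sgn (y k)}"
      using sgn_scaleR_cases[of "f k \<omega>" "y k"] by (simp only:)
    then show ?case by blast
  qed
  with borel_measurable_sgn_bochner[OF u] countable_signed_sgn show ?thesis
    by (rule essentially_countably_valuedI_AE)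
qed

lemma sgn_countable_imp_optimal_disjoint_series:
  fixes u :: "'a \<Rightarrow> 'b::banach"
  assumes u: "bochner_integrable M u"
    and c: "essentially_countably_valued M (\<lambda>\<omega>. sgn (u \<omega>))"
  obtains f y where "tensor_series M f y u"
    "\<And>i j. i \<noteq> j \<Longrightarrow> supp_on M (f i) \<inter> supp_on M (f j) = {}"
    "(\<lambda>i. L1_norm M (f i) * norm (y i)) sums projective_norm M u"
proof -
  obtain f y where f: "\<And>i::nat. integrable M (f i)"
    and disj: "\<And>i j. i \<noteq> j \<Longrightarrow> supp_on M (f i) \<inter> supp_on M (f j) = {}"
    and conv: "AE \<omega> in M. (\<lambda>i. f i \<omega> *\<^sub>R y i) sums u \<omega>"
    and cost: "(\<lambda>i. L1_norm M (f i) * norm (y i)) sums L1_norm M u"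
    by (rule radial_decomposition[OF bochner_integrable_norm[OF u] c]) (rule that)
  have "tensor_series M f y u"
    by (rule tensor_seriesI[where f = f, OF u f sums_summable[OF cost] conv])
  from this disj cost[folded projective_norm_eq_L1_norm[OF u]] show ?thesis by (rule that)
qed

section \<open>Countably valued norming functions\<close>

lemma sums_indicator_outside:
  fixes v :: "nat \<Rightarrow> 'b::real_normed_vector"
  assumes "\<And>i. \<omega> \<notin> A i"
  shows "(\<lambda>i. indicator (A i) \<omega> *\<^sub>R v i) sums 0"
  using assms by simp

text \<open>The partial sums are simple and, by disjointness, eventually constant at every point.
  The summand \<open>c\<close> is the value taken off all pieces.\<close>

lemma strongly_measurable_countable_pieces:
  fixes v :: "nat \<Rightarrow> 'b::real_normed_vector"
  assumes A: "\<And>i. A i \<in> sets M" "disjoint_family A"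
  shows "strongly_measurable M (\<lambda>\<omega>. c + (\<Sum>i. indicator (A i) \<omega> *\<^sub>R v i))"
  unfolding strongly_measurable_def
proof (intro exI[of _ "\<lambda>n \<omega>. c + (\<Sum>i<n. indicator (A i) \<omega> *\<^sub>R v i)"] conjI allI ballI)
  show "simple_function M (\<lambda>\<omega>. c + (\<Sum>i<n. indicator (A i) \<omega> *\<^sub>R v i))" for n
  proof (induction n)
    case (Suc n)
    have "simple_function M (\<lambda>\<omega>. (indicator (A n) \<omega> :: real) *\<^sub>R v n)"
      by (rule simple_function_compose1[where g = "\<lambda>r. r *\<^sub>R v n"]) (use A in simp)
    from simple_function_compose2[OF Suc this, of "(+)"] show ?case by (simp add: add.assoc)
  qed simp
  fix \<omega>
  have "summable (\<lambda>i. indicator (A i) \<omega> *\<^sub>R v i)"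
  proof (cases "\<exists>k. \<omega> \<in> A k")
    case True
    then show ?thesis using sums_indicator_disjoint_family[OF A(2)] sums_summable by blast
  next
    case False
    then show ?thesis using sums_indicator_outside[of \<omega> A v] sums_summable by blast
  qed
  then show "(\<lambda>n. c + (\<Sum>i<n. indicator (A i) \<omega> *\<^sub>R v i)) \<longlonglongrightarrow> c + (\<Sum>i. indicator (A i) \<omega> *\<^sub>R v i)"
    by (intro tendsto_intros summable_LIMSEQ)
qed

lemma norming_functional_norm_eq_1:
  fixes \<phi> :: "'b::real_normed_vector \<Rightarrow>\<^sub>L real"
  assumes "norm \<phi> \<le> 1" "blinfun_apply \<phi> y = norm y" "y \<noteq> 0"
  shows "norm \<phi> = 1"
  using norm_blinfun[of \<phi> y] assms by simp

lemma sgn_countable_imp_norming_function: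
  fixes u :: "'a \<Rightarrow> 'b::banach"
  assumes u: "bochner_integrable M u"
    and c: "essentially_countably_valued M (\<lambda>\<omega>. sgn (u \<omega>))"
    and M: "emeasure M (space M) \<noteq> 0" and y0: "(y0 :: 'b) \<noteq> 0"
  shows "\<exists>g :: 'a \<Rightarrow> 'b \<Rightarrow>\<^sub>L real. g \<in> Linf_unit_sphere M \<and> essentially_countably_valued M g \<and>
    dual_pairing M g u = L1_norm M u"
proof -
  obtain N A y where N: "N \<in> null_sets M" and A: "\<And>i::nat. A i \<in> sets M" "disjoint_family A"
    and UA: "(\<Union>i. A i) = space M - N" and val: "\<And>i \<omega>. \<omega> \<in> A i \<Longrightarrow> sgn (u \<omega>) = y i"
    using essentially_countably_valued_partition[OF c] by metis
  obtain \<Phi> :: "'b \<Rightarrow> 'b \<Rightarrow>\<^sub>L real" where \<Phi>: "\<And>x. norm (\<Phi> x) \<le> 1" "\<And>x. blinfun_apply (\<Phi> x) x = norm x"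
    using ex_norming_functional by metis
  \<comment> \<open>A functional chosen for the vector 0 could have norm below 1, so
    \<open>\<Phi> y0\<close> replaces it; \<open>g\<close> then has norm 1 at every point.\<close>
  define \<psi> where "\<psi> i = (if y i = 0 then \<Phi> y0 else \<Phi> (y i))" for i
  \<comment> \<open>Each piece corrects the default \<open>\<Phi> y0\<close> to
    \<open>\<psi> i\<close>, so the default remains on the exceptional null set.\<close>
  define g where "g \<omega> = \<Phi> y0 + (\<Sum>i. indicator (A i) \<omega> *\<^sub>R (\<psi> i - \<Phi> y0))" for \<omega>
  have gA: "g \<omega> = \<psi> k" if "\<omega> \<in> A k" for \<omega> k
    using sums_unique[OF sums_indicator_disjoint_family[OF A(2) that, of "\<lambda>i. \<psi> i - \<Phi> y0"], symmetric]
    by (simp add: g_def)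
  have g_out: "g \<omega> = \<Phi> y0" if "\<And>k. \<omega> \<notin> A k" for \<omega>
    using that by (simp add: g_def)
  have range: "g \<omega> \<in> insert (\<Phi> y0) (range \<psi>)" for \<omega>
    using gA g_out by blast
  have "norm (\<Phi> x) = 1" if "x \<noteq> 0" for x
    by (rule norming_functional_norm_eq_1[OF \<Phi> that])
  then have norm_g: "norm (g \<omega>) = 1" for \<omega>
    using range[of \<omega>] y0 by (auto simp: \<psi>_def)
  have sm: "strongly_measurable M g"
    unfolding g_def by (rule strongly_measurable_countable_pieces[OF A])
  have "g \<in> Linf_unit_sphere M"
    using sm by (simp add: Linf_unit_sphere_def norm_g esssup_const[OF M])
  moreover have "essentially_countably_valued M g"
    by (rule essentially_countably_valuedI_AE[OF borel_measurable_strongly_measurable[OF sm],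
          of "insert (\<Phi> y0) (range \<psi>)"]) (use range in auto)
  moreover have "dual_pairing M g u = L1_norm M u"
    unfolding dual_pairing_def L1_norm_def
  proof (rule integral_cong_AE)
    have um: "strongly_measurable M u" by (rule bochner_integrable_strongly_measurable[OF u])
    show "(\<lambda>\<omega>. blinfun_apply (g \<omega>) (u \<omega>)) \<in> borel_measurable M"
      by (rule borel_measurable_strongly_measurable[OF strongly_measurable_blinfun_apply[OF sm um]])
    show "(\<lambda>\<omega>. norm (u \<omega>)) \<in> borel_measurable M" by (rule borel_measurable_norm_strong[OF um])
    have "AE \<omega> in M. \<omega> \<in> (\<Union>i. A i)" unfolding UA by (intro AE_I'[OF N]) auto
    then show "AE \<omega> in M. blinfun_apply (g \<omega>) (u \<omega>) = norm (u \<omega>)"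
    proof eventually_elim
      case (elim \<omega>)
      then obtain k where k: "\<omega> \<in> A k" by blast
      show ?case
      proof (cases "u \<omega> = 0")
        case False
        then have "y k \<noteq> 0" using val[OF k] by (simp add: sgn_zero_iff flip: val[OF k])
        then have "blinfun_apply (g \<omega>) (sgn (u \<omega>)) = 1"
          using gA[OF k] \<Phi>(2)[of "y k"] val[OF k, symmetric] False by (simp add: \<psi>_def norm_sgn)
        then show ?thesis using blinfun_eq_norm_iff_sgn[OF False] by blast
      qed simp
    qed
  qed
  ultimately show ?thesis by blast
qed

text \<open>Equality of the integrals makes \<open>g \<omega>\<close> norm \<open>u \<omega>\<close>
  almost everywhere, and a single functional norms one direction at most. Countably many values of
  \<open>g\<close> thus leave countably many directions.\<close>

lemma norming_function_imp_sgn_countable: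
  fixes u :: "'a \<Rightarrow> 'b::banach" and g :: "'a \<Rightarrow> 'b \<Rightarrow>\<^sub>L real"
  assumes sc: "strictly_convex_space TYPE('b)" and u: "bochner_integrable M u"
    and g: "g \<in> Linf_unit_sphere M" "essentially_countably_valued M g"
    and dual: "dual_pairing M g u = L1_norm M u"
  shows "essentially_countably_valued M (\<lambda>\<omega>. sgn (u \<omega>))"
proof -
  have um: "strongly_measurable M u" by (rule bochner_integrable_strongly_measurable[OF u])
  have gm: "strongly_measurable M g" and ess: "esssup M (\<lambda>\<omega>. ereal (norm (g \<omega>))) = 1"
    using g(1) by (simp_all add: Linf_unit_sphere_def)
  have g1: "AE \<omega> in M. norm (g \<omega>) \<le> 1"
    using esssup_AE[of "\<lambda>\<omega>. ereal (norm (g \<omega>))" M] by (simp add: ess)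
  then have bound: "AE \<omega> in M. \<bar>blinfun_apply (g \<omega>) (u \<omega>)\<bar> \<le> norm (u \<omega>)"
    by eventually_elim (rule abs_blinfun_le_norm)
  have int: "integrable M (\<lambda>\<omega>. blinfun_apply (g \<omega>) (u \<omega>))"
    by (rule Bochner_Integration.integrable_bound[OF bochner_integrable_norm[OF u]
          borel_measurable_strongly_measurable[OF strongly_measurable_blinfun_apply[OF gm um]]])
      (use bound in simp)
  have "AE \<omega> in M. blinfun_apply (g \<omega>) (u \<omega>) \<le> norm (u \<omega>)"
    using bound by eventually_elim simp
  from integral_ineq_eq_0_then_AE[OF this int bochner_integrable_norm[OF u]] dual
  have eq: "AE \<omega> in M. blinfun_apply (g \<omega>) (u \<omega>) = norm (u \<omega>)"
    by (simp add: dual_pairing_def L1_norm_def)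
  obtain N where N: "N \<in> null_sets M" "countable (g ` (space M - N))"
    using g(2) unfolding essentially_countably_valued_def by blast
  \<comment> \<open>\<open>T\<close> sends a functional to the direction it norms. By strict
    convexity the choice is immaterial; the value is arbitrary when no nonzero vector is
    normed.\<close>
  define T where "T \<phi> = (SOME z. \<exists>x. x \<noteq> 0 \<and> blinfun_apply \<phi> x = norm x \<and> z = sgn x)"
    for \<phi> :: "'b \<Rightarrow>\<^sub>L real"
  have T: "T \<phi> = sgn x" if \<phi>: "norm \<phi> \<le> 1" and x: "x \<noteq> 0" "blinfun_apply \<phi> x = norm x" for \<phi> x
  proof -
    have "\<exists>x'. x' \<noteq> 0 \<and> blinfun_apply \<phi> x' = norm x' \<and> T \<phi> = sgn x'"
      unfolding T_def by (rule someI_ex) (use x in blast)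
    then show ?thesis using strictly_convex_sgn_unique[OF sc \<phi> _ _ x] by metis
  qed
  have "AE \<omega> in M. \<omega> \<in> space M - N" using N(1) by (intro AE_I'[OF N(1)]) auto
  with g1 eq have "AE \<omega> in M. sgn (u \<omega>) \<in> insert 0 (T ` g ` (space M - N))"
  proof eventually_elim
    case (elim \<omega>)
    show ?case
    proof (cases "u \<omega> = 0")
      case False
      have "T (g \<omega>) \<in> T ` g ` (space M - N)" using elim(3) by (intro imageI)
      with T[OF elim(1) False elim(2)] show ?thesis by (metis insertI2)
    qed simp
  qed
  from essentially_countably_valuedI_AE[OF borel_measurable_sgn_bochner[OF u] _ this] N(2)
  show ?thesis by simp
qed

section \<open>Attained total variation\<close>

lemma
  fixes u :: "'a \<Rightarrow> 'b::banach"
  assumes u: "bochner_integrable M u" and A: "\<And>n::nat. A n \<in> sets M" "disjoint_family A"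
  shows integrable_indicator_UN_norm: "integrable M (\<lambda>\<omega>. indicator (\<Union>n. A n) \<omega> * norm (u \<omega>))"
    and sums_integral_indicator_norm:
      "(\<lambda>n. \<integral>\<omega>. indicator (A n) \<omega> * norm (u \<omega>) \<partial>M) sums (\<integral>\<omega>. indicator (\<Union>n. A n) \<omega> * norm (u \<omega>) \<partial>M)"
proof -
  have UA: "(\<Union>n. A n) \<in> sets M" using A(1) by blast
  show int: "integrable M (\<lambda>\<omega>. indicator (\<Union>n. A n) \<omega> * norm (u \<omega>))"
    by (rule integrable_indicator_norm[OF bochner_integrable_norm[OF u] UA])
  have "(\<lambda>n. indicator (A n) \<omega> * norm (u \<omega>)) sums (indicator (\<Union>n. A n) \<omega> * norm (u \<omega>))" for \<omega>
  proof (cases "\<exists>k. \<omega> \<in> A k")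
    case True
    then obtain k where "\<omega> \<in> A k" by blast
    from sums_indicator_disjoint_family[OF A(2) this, of "\<lambda>_. norm (u \<omega>)"] show ?thesis
      using True by simp
  qed simp
  then show "(\<lambda>n. \<integral>\<omega>. indicator (A n) \<omega> * norm (u \<omega>) \<partial>M) sums (\<integral>\<omega>. indicator (\<Union>n. A n) \<omega> * norm (u \<omega>) \<partial>M)"
    by (intro integral_sums_nonneg integrable_indicator_norm[OF bochner_integrable_norm[OF u] A(1)] int)
      simp_all
qed

text \<open>On a level set all nonzero values of \<open>u\<close> lie on one ray, so one functional
  norms them all and passing to the norm of the integral loses nothing.\<close>

lemma sgn_countable_imp_attains_total_variation:
  fixes u :: "'a \<Rightarrow> 'b::banach"
  assumes u: "bochner_integrable M u"
    and c: "essentially_countably_valued M (\<lambda>\<omega>. sgn (u \<omega>))"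
  shows "attains_total_variation M u"
proof -
  obtain N A y where N: "N \<in> null_sets M" and A: "\<And>i::nat. A i \<in> sets M" "disjoint_family A"
    and UA: "(\<Union>i. A i) = space M - N" and val: "\<And>i \<omega>. \<omega> \<in> A i \<Longrightarrow> sgn (u \<omega>) = y i"
    using essentially_countably_valued_partition[OF c] by metis
  have "norm (indefinite_integral M u (A n)) = (\<integral>\<omega>. indicator (A n) \<omega> * norm (u \<omega>) \<partial>M)" for n
  proof (rule antisym[OF norm_indefinite_integral_le[OF u A(1)]])
    obtain \<phi> :: "'b \<Rightarrow>\<^sub>L real" where \<phi>: "norm \<phi> \<le> 1" "blinfun_apply \<phi> (y n) = norm (y n)"
      using ex_norming_functional by blast
    have "blinfun_apply \<phi> (u \<omega>) = norm (u \<omega>)" if "\<omega> \<in> A n" for \<omega>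
    proof (cases "u \<omega> = 0")
      case False
      then have "blinfun_apply \<phi> (sgn (u \<omega>)) = 1"
        using \<phi>(2) val[OF that, symmetric] by (simp add: norm_sgn)
      then show ?thesis using blinfun_eq_norm_iff_sgn[OF False] by blast
    qed simp
    then have "(\<integral>\<omega>. indicator (A n) \<omega> * norm (u \<omega>) \<partial>M) = (\<integral>\<omega>. indicator (A n) \<omega> * blinfun_apply \<phi> (u \<omega>) \<partial>M)"
      by (intro Bochner_Integration.integral_cong) (auto split: split_indicator)
    also have "\<dots> = blinfun_apply \<phi> (indefinite_integral M u (A n))"
      by (rule indefinite_integral_functional(2)[OF u A(1) \<phi>(1)])
    also have "\<dots> \<le> norm (indefinite_integral M u (A n))"
      using abs_blinfun_le_norm[OF \<phi>(1), of "indefinite_integral M u (A n)"] by simp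
    finally show "(\<integral>\<omega>. indicator (A n) \<omega> * norm (u \<omega>) \<partial>M) \<le> norm (indefinite_integral M u (A n))" .
  qed
  moreover have "(\<integral>\<omega>. indicator (\<Union>n. A n) \<omega> * norm (u \<omega>) \<partial>M) = L1_norm M u"
    unfolding L1_norm_def
  proof (rule integral_cong_AE)
    show "AE \<omega> in M. indicator (\<Union>n. A n) \<omega> * norm (u \<omega>) = norm (u \<omega>)"
      unfolding UA by (intro AE_I'[OF N]) (auto split: split_indicator_asm)
  qed (use integrable_indicator_UN_norm[OF u A] bochner_integrable_norm[OF u] in \<open>auto intro: borel_measurable_integrable\<close>)
  ultimately have "(\<lambda>n. norm (indefinite_integral M u (A n))) sums total_variation M u"
    using sums_integral_indicator_norm[OF u A] by (simp add: total_variation_eq_L1_norm[OF u])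
  with A show ?thesis unfolding attains_total_variation_def by blast
qed

text \<open>Summing \<open>norm (x n) \<le> a n\<close> traps \<open>L1_norm M u\<close> between
  equal ends, so every inequality is sharp: \<open>u\<close> vanishes almost everywhere off the
  union, and a functional norming \<open>x n\<close> norms \<open>u \<omega>\<close> at almost every
  point of \<open>A n\<close>.\<close>

lemma attains_total_variation_imp_sgn_countable:
  fixes u :: "'a \<Rightarrow> 'b::banach"
  assumes sc: "strictly_convex_space TYPE('b)" and u: "bochner_integrable M u"
    and att: "attains_total_variation M u"
  shows "essentially_countably_valued M (\<lambda>\<omega>. sgn (u \<omega>))"
proof -
  obtain A where A: "\<And>n::nat. A n \<in> sets M" "disjoint_family A"
    and att': "(\<lambda>n. norm (indefinite_integral M u (A n))) sums L1_norm M u"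
    using att unfolding attains_total_variation_def total_variation_eq_L1_norm[OF u] by blast
  define x where "x n = indefinite_integral M u (A n)" for n
  define a where "a n = (\<integral>\<omega>. indicator (A n) \<omega> * norm (u \<omega>) \<partial>M)" for n
  let ?U = "\<Union>n. A n"
  note nu = bochner_integrable_norm[OF u]
  note Uint = integrable_indicator_UN_norm[OF u A]
  have aU: "a sums (\<integral>\<omega>. indicator ?U \<omega> * norm (u \<omega>) \<partial>M)"
    unfolding a_def by (rule sums_integral_indicator_norm[OF u A])
  have x_sums: "(\<lambda>n. norm (x n)) sums L1_norm M u" using att' by (simp add: x_def)
  have xa: "norm (x n) \<le> a n" for n
    unfolding x_def a_def by (rule norm_indefinite_integral_le[OF u A(1)])
  have Ule: "(\<integral>\<omega>. indicator ?U \<omega> * norm (u \<omega>) \<partial>M) \<le> L1_norm M u"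
    unfolding L1_norm_def by (rule integral_mono[OF Uint nu]) (auto split: split_indicator)
  moreover have "L1_norm M u \<le> (\<integral>\<omega>. indicator ?U \<omega> * norm (u \<omega>) \<partial>M)"
    by (rule sums_le[OF xa x_sums aU])
  ultimately have Ueq: "(\<integral>\<omega>. indicator ?U \<omega> * norm (u \<omega>) \<partial>M) = L1_norm M u" by simp
  have diff: "(\<lambda>n. a n - norm (x n)) sums 0"
    using sums_diff[OF aU x_sums] Ueq by simp
  have xa_eq: "norm (x n) = a n" for n
    using suminf_eq_zero_iff[OF sums_summable[OF diff]] sums_unique[OF diff] xa by simp
  have "AE \<omega> in M. indicator ?U \<omega> * norm (u \<omega>) = norm (u \<omega>)"
    by (rule integral_ineq_eq_0_then_AE[OF _ Uint nu])
      (use Ueq in \<open>auto simp: L1_norm_def split: split_indicator\<close>)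
  then have cover: "AE \<omega> in M. u \<omega> = 0 \<or> (\<exists>n. \<omega> \<in> A n)"
    by eventually_elim (auto split: split_indicator_asm)
  have "AE \<omega> in M. \<omega> \<in> A n \<longrightarrow> sgn (u \<omega>) \<in> {0, sgn (x n)}" for n
  proof -
    obtain \<phi> :: "'b \<Rightarrow>\<^sub>L real" where \<phi>: "norm \<phi> \<le> 1" "blinfun_apply \<phi> (x n) = norm (x n)"
      using ex_norming_functional by blast
    note nA = integrable_indicator_norm[OF nu A(1)[of n]]
    have "AE \<omega> in M. indicator (A n) \<omega> * blinfun_apply \<phi> (u \<omega>) = indicator (A n) \<omega> * norm (u \<omega>)"
    proof (rule integral_ineq_eq_0_then_AE[OF _ indefinite_integral_functional(1)[OF u A(1) \<phi>(1)] nA])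
      show "AE \<omega> in M. indicator (A n) \<omega> * blinfun_apply \<phi> (u \<omega>) \<le> indicator (A n) \<omega> * norm (u \<omega>)"
        using abs_blinfun_le_norm[OF \<phi>(1)]
        by (auto split: split_indicator intro: order_trans[OF abs_ge_self])
      show "(\<integral>\<omega>. indicator (A n) \<omega> * blinfun_apply \<phi> (u \<omega>) \<partial>M) = (\<integral>\<omega>. indicator (A n) \<omega> * norm (u \<omega>) \<partial>M)"
        using indefinite_integral_functional(2)[OF u A(1)[of n] \<phi>(1)] \<phi>(2) xa_eq[of n]
        by (simp add: x_def a_def)
    qed
    \<comment> \<open>A vanishing \<open>x n\<close> has no direction to compare with; but then
      \<open>a n = 0\<close>, so \<open>u\<close> is zero almost everywhere on
      \<open>A n\<close>.\<close>
    moreover have "AE \<omega> in M. x n = 0 \<longrightarrow> indicator (A n) \<omega> * norm (u \<omega>) = 0"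
    proof (cases "x n = 0")
      case True
      then have "(\<integral>\<omega>. indicator (A n) \<omega> * norm (u \<omega>) \<partial>M) = 0" using xa_eq[of n] by (simp add: a_def)
      then show ?thesis using integral_nonneg_eq_0_iff_AE[OF nA] by simp
    qed simp
    ultimately show ?thesis
    proof eventually_elim
      case (elim \<omega>)
      show ?case
        using elim strictly_convex_sgn_unique[OF sc \<phi>(1), of "u \<omega>" "x n"] \<phi>(2)
        by (cases "u \<omega> = 0"; cases "x n = 0") auto
    qed
  qed
  then have "AE \<omega> in M. \<forall>n. \<omega> \<in> A n \<longrightarrow> sgn (u \<omega>) \<in> {0, sgn (x n)}"
    by (simp add: AE_all_countable)
  with cover have "AE \<omega> in M. sgn (u \<omega>) \<in> insert 0 (range (\<lambda>n. sgn (x n)))"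
    by eventually_elim auto
  from essentially_countably_valuedI_AE[OF borel_measurable_sgn_bochner[OF u] _ this]
  show ?thesis by simp
qed

theorem theorem3p6:
  fixes M :: "'a measure" and u :: "'a \<Rightarrow> 'b::banach"
  assumes "strictly_convex_space TYPE('b)"
    and "bochner_integrable M u"
  shows "(attains_projective_norm M u \<longleftrightarrow>
      (\<exists>f y. tensor_series M f y u \<and>
        (\<forall>i j. i \<noteq> j \<longrightarrow> emeasure M (supp_on M (f i) \<inter> supp_on M (f j)) = 0)))
    \<and> (attains_projective_norm M u \<longleftrightarrow>
      essentially_countably_valued M (\<lambda>\<omega>. sgn (u \<omega>)))
    \<and> (emeasure M (space M) \<noteq> 0 \<and> (\<exists>y::'b. y \<noteq> 0) \<longrightarrow>
      (attains_projective_norm M u \<longleftrightarrow>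
        (\<exists>g :: 'a \<Rightarrow> 'b \<Rightarrow>\<^sub>L real. g \<in> Linf_unit_sphere M \<and> essentially_countably_valued M g \<and>
          dual_pairing M g u = L1_norm M u)))
    \<and> (attains_projective_norm M u \<longleftrightarrow> attains_total_variation M u)"
proof -
  let ?iii = "essentially_countably_valued M (\<lambda>\<omega>. sgn (u \<omega>))"
  let ?ii = "\<exists>f y. tensor_series M f y u \<and>
    (\<forall>i j. i \<noteq> j \<longrightarrow> emeasure M (supp_on M (f i) \<inter> supp_on M (f j)) = 0)"
  let ?iv = "\<exists>g :: 'a \<Rightarrow> 'b \<Rightarrow>\<^sub>L real. g \<in> Linf_unit_sphere M \<and> essentially_countably_valued M g \<and>
    dual_pairing M g u = L1_norm M u"
  have opt: "attains_projective_norm M u \<and> ?ii" if c: ?iii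
  proof -
    obtain f y where "tensor_series M f y u"
      "\<And>i j. i \<noteq> j \<Longrightarrow> supp_on M (f i) \<inter> supp_on M (f j) = {}"
      "(\<lambda>i. L1_norm M (f i) * norm (y i)) sums projective_norm M u"
      by (rule sgn_countable_imp_optimal_disjoint_series[OF assms(2) c]) (rule that)
    then show ?thesis
      unfolding attains_projective_norm_def by (metis emeasure_empty)
  qed
  have i_iii: "attains_projective_norm M u \<longleftrightarrow> ?iii"
    using opt attains_projective_norm_imp_sgn_countable[OF assms] by blast
  moreover have "?ii \<longleftrightarrow> ?iii"
    using opt disjoint_tensor_series_imp_sgn_countable[OF assms(2)] by blast
  \<comment> \<open>Both conditions feed the construction of \<open>g\<close>: positive measure
    gives a constant function its value as essential supremum, and a nonzero vector yields a
    functional of norm exactly 1.\<close>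
  moreover have "?iv \<longleftrightarrow> ?iii" if "emeasure M (space M) \<noteq> 0" "\<exists>y::'b. y \<noteq> 0"
    using that sgn_countable_imp_norming_function[OF assms(2)]
      norming_function_imp_sgn_countable[OF assms] by blast
  moreover have "attains_total_variation M u \<longleftrightarrow> ?iii"
    using sgn_countable_imp_attains_total_variation[OF assms(2)]
      attains_total_variation_imp_sgn_countable[OF assms] by blast
  ultimately show ?thesis by (intro conjI impI) simp_all
qed

end
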